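(* There is a constant $K<24$ such that for every $n\ge 2$ and every $\epsilon\ge0$, every weakly $\epsilon$-modular set function over $[n]$ is $K\epsilon$-linear; hence the weak Kalton constant satisfies $K_w<24$. Moreover, there is an integer-valued set function over a ground set of $20$ items that is weakly $2$-modular and tightly $3$-linear; hence $K_w\ge 3/2$.
   Context: A set function on a finite ground set $U$ is a map $f:2^U\to\mathbb{R}$. It is weakly $\epsilon$-modular if $|f(S)+f(T)-f(S\cup T)-f(S\cap T)|\le\epsilon$ for all disjoint $S,T\subseteq U$. It is linear if there are constants $c_0$ and $c_i$ ($i\in U$) with $f(S)=c_0+\sum_{i\in S}c_i$ for all $S$. It is $\Delta$-linear if some linear set function $\ell$ satisfies $|f(S)-\ell(S)|\le\Delta$ for all $S$; tightly $\Delta$-linear if it is $\Delta$-linear but not $\Delta'$-linear for any $\Delta'<\Delta$. The weak Kalton constant $K_w$ is the smallest constant such that for every $n$ and every $\epsilon\ge0$, every weakly $\epsilon$-modular set function over $[n]$ is $K_w\epsilon$-linear. *)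

theory Defs
  imports Complex_Main
begin

(* A set function over a finite ground set U is represented by a total function on sets of
   which only the values on subsets of U matter; every predicate below is relative to U. *)

definition weakly_modular :: "'a set \<Rightarrow> real \<Rightarrow> ('a set \<Rightarrow> real) \<Rightarrow> bool" where
  "weakly_modular U \<epsilon> f \<longleftrightarrow>
     (\<forall>S T. S \<subseteq> U \<longrightarrow> T \<subseteq> U \<longrightarrow> S \<inter> T = {} \<longrightarrow>
        \<bar>f S + f T - f (S \<union> T) - f (S \<inter> T)\<bar> \<le> \<epsilon>)"

definition linear_set_fun :: "'a set \<Rightarrow> ('a set \<Rightarrow> real) \<Rightarrow> bool" where
  "linear_set_fun U l \<longleftrightarrow> (\<exists>c0 c. \<forall>S. S \<subseteq> U \<longrightarrow> l S = c0 + (\<Sum>i\<in>S. c i))"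

definition delta_linear :: "'a set \<Rightarrow> real \<Rightarrow> ('a set \<Rightarrow> real) \<Rightarrow> bool" where
  "delta_linear U \<Delta> f \<longleftrightarrow>
     (\<exists>l. linear_set_fun U l \<and> (\<forall>S. S \<subseteq> U \<longrightarrow> \<bar>f S - l S\<bar> \<le> \<Delta>))"

definition tightly_linear :: "'a set \<Rightarrow> real \<Rightarrow> ('a set \<Rightarrow> real) \<Rightarrow> bool" where
  "tightly_linear U \<Delta> f \<longleftrightarrow>
     delta_linear U \<Delta> f \<and> (\<forall>\<Delta>'. \<Delta>' < \<Delta> \<longrightarrow> \<not> delta_linear U \<Delta>' f)"

(* LEAST is unspecified if no smallest constant exists, so any bound on this constant
   has to establish that the smallest one is attained. *)
definition weak_Kalton_constant :: real where
  "weak_Kalton_constant =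
     (LEAST K. \<forall>(n::nat) \<epsilon> f. \<epsilon> \<ge> 0 \<longrightarrow> weakly_modular {1..n} \<epsilon> f \<longrightarrow>
        delta_linear {1..n} (K * \<epsilon>) f)"

end

(* Upper bound. By linear programming duality, f is Delta-linear iff E_p f - E_q f <= 2 Delta for all
   distributions p, q on sets under which every item has the same probability. Mixing p with the
   complements of q gives a distribution nu under which every item has probability 1/2. Take
   independent sets with law nu at the 3-valent nodes of the (3,4)-biregular tree; each one splits
   into three pieces, sent to the adjacent 4-valent hosts, and each host receives an item at most
   once, so that the four pieces it receives are disjoint and merge into one set. Since only finitely many
   items are around, it is enough that a single random half of the 3-valent nodes can be matched
   into the hosts up to a vanishing error, and a peeling process achieves this: the density x of
   unmatched nodes evolves by x -> (1 - (1 - x)^3)^2 / 2, which tends to 0. There are 3/4 as many hosts as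
   sets, so a bound |f| <= Delta improves to distance 3/4 Delta + 19/4 epsilon from a linear function,
   and iterating gives 19 epsilon.

   Lower bound. The items are the 3-subsets of a 6-set. The function is 3 on the six stars (the items
   containing a given point) and -3 on their complements; it is -1, 0 or 1 elsewhere. Every item
   lies in three stars and in three complements, so no linear function can be closer than 3. *)

theory Submission
  imports Defs "HOL-Probability.Probability_Mass_Function"
begin

subsection \<open>Linear programming duality\<close>

text \<open>A pair \<open>(a, b)\<close> stands for the inequality bounding the sum of
  \<open>a i * x i\<close> by \<open>b\<close>. The set holds the inequalities that follow from
  \<open>Q\<close> with nonnegative multipliers; generating them inductively avoids carrying
  multipliers through the elimination.\<close>

inductive_set nonneg_comb :: "(('i \<Rightarrow> real) \<times> real) set \<Rightarrow> (('i \<Rightarrow> real) \<times> real) set"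
  for Q where
  base: "q \<in> Q \<Longrightarrow> q \<in> nonneg_comb Q"
| add: "(a, b) \<in> nonneg_comb Q \<Longrightarrow> (a', b') \<in> nonneg_comb Q \<Longrightarrow> (\<lambda>i. a i + a' i, b + b') \<in> nonneg_comb Q"
| scale: "(a, b) \<in> nonneg_comb Q \<Longrightarrow> c \<ge> 0 \<Longrightarrow> (\<lambda>i. c * a i, c * b) \<in> nonneg_comb Q"

lemma nonneg_comb_trans:
  assumes "q \<in> nonneg_comb Q'" "Q' \<subseteq> nonneg_comb Q"
  shows "q \<in> nonneg_comb Q"
  using assms by (induction rule: nonneg_comb.induct) (auto intro: nonneg_comb.intros)

lemma ex_real_between:
  fixes L R :: "real set"
  assumes "finite L" "finite R" "\<And>l r. l \<in> L \<Longrightarrow> r \<in> R \<Longrightarrow> l \<le> r"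
  shows "\<exists>t. (\<forall>l\<in>L. l \<le> t) \<and> (\<forall>r\<in>R. t \<le> r)"
proof (cases "L = {}")
  case True
  show ?thesis
  proof (cases "R = {}")
    case False
    then show ?thesis using True assms(2) by (intro exI[of _ "Min R"]) auto
  qed (use True in auto)
next
  case False
  then show ?thesis using assms by (intro exI[of _ "Max L"]) auto
qed

text \<open>Farkas' lemma, by Fourier--Motzkin elimination of the variables one at a time.\<close>
lemma farkas:
  assumes "finite I" "finite Q"
    and "\<And>a b. (a, b) \<in> nonneg_comb Q \<Longrightarrow> \<forall>i\<in>I. a i = 0 \<Longrightarrow> 0 \<le> b"
  shows "\<exists>x. \<forall>(a, b)\<in>Q. (\<Sum>i\<in>I. a i * x i) \<le> b"
  using assms
proof (induction I arbitrary: Q rule: finite_induct)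
  case empty
  then show ?case by (auto intro: nonneg_comb.base)
next
  case (insert k I)
  define P where "P = {q \<in> Q. fst q k > 0}"
  define N where "N = {q \<in> Q. fst q k < 0}"
  \<comment> \<open>The scaling makes the coefficients at \<open>k\<close> equal to 1 and -1, so
    that they cancel in the sum.\<close>
  define comb where "comb = (\<lambda>(q :: ('a \<Rightarrow> real) \<times> real, q' :: ('a \<Rightarrow> real) \<times> real).
      (\<lambda>i. (1 / fst q k) * fst q i + (1 / - fst q' k) * fst q' i,
       (1 / fst q k) * snd q + (1 / - fst q' k) * snd q'))"
  define Q' where "Q' = {q \<in> Q. fst q k = 0} \<union> comb ` (P \<times> N)"
  have fin: "finite Q'" "finite P" "finite N"
    using insert.prems(1) by (auto simp: Q'_def P_def N_def)
  have comb_in: "comb (q, q') \<in> nonneg_comb Q" if q: "q \<in> P" and q': "q' \<in> N" for q q'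
  proof -
    have "(\<lambda>i. (1 / fst q k) * fst q i, (1 / fst q k) * snd q) \<in> nonneg_comb Q"
      using q by (intro nonneg_comb.scale nonneg_comb.base) (auto simp: P_def)
    moreover have "(\<lambda>i. (1 / - fst q' k) * fst q' i, (1 / - fst q' k) * snd q') \<in> nonneg_comb Q"
      using q' by (intro nonneg_comb.scale nonneg_comb.base) (auto simp: N_def)
    ultimately show ?thesis unfolding comb_def prod.case by (rule nonneg_comb.add)
  qed
  then have sub: "Q' \<subseteq> nonneg_comb Q" by (auto simp: Q'_def intro: nonneg_comb.base)
  \<comment> \<open>No inequality derived from \<open>Q'\<close> involves \<open>k\<close>. Hence a
    combination vanishing on \<open>I\<close> vanishes on \<open>insert k I\<close>, where the
    hypothesis on \<open>Q\<close> applies.\<close>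
  have zero: "fst q k = 0" if "q \<in> nonneg_comb Q'" for q
    using that by (induction rule: nonneg_comb.induct) (auto simp: Q'_def comb_def P_def N_def)
  have "\<exists>x. \<forall>(a, b)\<in>Q'. (\<Sum>i\<in>I. a i * x i) \<le> b"
  proof (rule insert.IH[OF fin(1)])
    fix a b assume "(a, b) \<in> nonneg_comb Q'" "\<forall>i\<in>I. a i = 0"
    then show "0 \<le> b" using insert.prems(2)[of a b] nonneg_comb_trans[OF _ sub] zero by fastforce
  qed
  then obtain x where x: "\<And>a b. (a, b) \<in> Q' \<Longrightarrow> (\<Sum>i\<in>I. a i * x i) \<le> b" by fast
  \<comment> \<open>This is the bound that \<open>q\<close> puts on the value of variable
    \<open>k\<close>: an upper bound for \<open>q\<close> in \<open>P\<close>, a lower bound for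
    \<open>q\<close> in \<open>N\<close>.\<close>
  define bd where "bd = (\<lambda>q. (snd q - (\<Sum>i\<in>I. fst q i * x i)) / fst q k)"
  have "\<exists>t. (\<forall>l\<in>bd ` N. l \<le> t) \<and> (\<forall>r\<in>bd ` P. t \<le> r)"
  proof (rule ex_real_between)
    fix l r assume "l \<in> bd ` N" "r \<in> bd ` P"
    then obtain q q' where q: "q \<in> P" "q' \<in> N" "l = bd q'" "r = bd q" by blast
    have "comb (q, q') \<in> Q'" using q by (auto simp: Q'_def)
    then have "(\<Sum>i\<in>I. fst (comb (q, q')) i * x i) \<le> snd (comb (q, q'))"
      using x[of "fst (comb (q, q'))" "snd (comb (q, q'))"] by simp
    moreover have "(\<Sum>i\<in>I. fst (comb (q, q')) i * x i)
        = (1 / fst q k) * (\<Sum>i\<in>I. fst q i * x i) + (1 / - fst q' k) * (\<Sum>i\<in>I. fst q' i * x i)"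
      by (simp add: comb_def sum_distrib_left algebra_simps flip: sum.distrib sum_subtractf)
    ultimately show "l \<le> r"
      unfolding q(3,4) bd_def comb_def by (simp add: diff_divide_distrib)
  qed (use fin in auto)
  then obtain t where t: "\<And>q. q \<in> N \<Longrightarrow> bd q \<le> t" "\<And>q. q \<in> P \<Longrightarrow> t \<le> bd q" by auto
  define y where "y = x(k := t)"
  have y: "(\<Sum>i\<in>insert k I. a i * y i) = a k * t + (\<Sum>i\<in>I. a i * x i)" for a
  proof -
    have "(\<Sum>i\<in>I. a i * y i) = (\<Sum>i\<in>I. a i * x i)"
      using insert.hyps by (intro sum.cong) (auto simp: y_def)
    then show ?thesis using insert.hyps by (simp add: y_def)
  qed
  have "(\<Sum>i\<in>insert k I. a i * y i) \<le> b" if ab: "(a, b) \<in> Q" for a b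
  proof -
    consider "a k = 0" | "a k > 0" | "a k < 0" by linarith
    then show ?thesis
    proof cases
      case 1
      then show ?thesis using x[of a b] ab by (simp add: y Q'_def del: sum.insert)
    next
      case 2
      then have "t \<le> (b - (\<Sum>i\<in>I. a i * x i)) / a k"
        using t(2)[of "(a, b)"] ab by (simp add: P_def bd_def)
      then show ?thesis using 2 by (simp add: y field_simps del: sum.insert)
    next
      case 3
      then have "(b - (\<Sum>i\<in>I. a i * x i)) / a k \<le> t"
        using t(1)[of "(a, b)"] ab by (simp add: N_def bd_def)
      then show ?thesis using 3 by (simp add: y field_simps del: sum.insert)
    qed
  qed
  then show ?case by blast
qed

section \<open>Pairs of distributions with equal item marginals as dual certificates\<close>

definition balanced :: "'a set \<Rightarrow> 'a set pmf \<Rightarrow> 'a set pmf \<Rightarrow> bool" where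
  "balanced U p q \<longleftrightarrow> set_pmf p \<subseteq> Pow U \<and> set_pmf q \<subseteq> Pow U \<and>
     (\<forall>i\<in>U. measure_pmf.prob p {S. i \<in> S} = measure_pmf.prob q {S. i \<in> S})"

lemma expectation_pmf_Pow:
  fixes f :: "'a set \<Rightarrow> real"
  assumes "finite U" "set_pmf p \<subseteq> Pow U"
  shows "measure_pmf.expectation p f = (\<Sum>S\<in>Pow U. pmf p S * f S)"
  using assms by (subst integral_measure_pmf_real[where A = "Pow U"]) (auto simp: mult.commute)

lemma prob_pmf_Pow:
  assumes "finite U" "set_pmf p \<subseteq> Pow U"
  shows "measure_pmf.prob p {S. i \<in> S} = (\<Sum>S\<in>Pow U. pmf p S * of_bool (i \<in> S))"
proof -
  have "measure_pmf.prob p {S. i \<in> S} = measure_pmf.expectation p (indicator {S. i \<in> S})"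
    by simp
  also have "\<dots> = (\<Sum>S\<in>Pow U. pmf p S * of_bool (i \<in> S))"
    using assms by (subst expectation_pmf_Pow[of U]) (auto simp: indicator_def)
  finally show ?thesis .
qed

lemma sum_pmf_Pow:
  assumes "finite U" "set_pmf p \<subseteq> Pow U"
  shows "(\<Sum>S\<in>Pow U. pmf p S) = 1"
  using assms by (intro sum_pmf_eq_1) auto

lemma ex_pmf_of_weights:
  fixes w :: "'b \<Rightarrow> real"
  assumes "finite A" "\<And>x. x \<in> A \<Longrightarrow> 0 \<le> w x" "sum w A = 1"
  shows "\<exists>p. set_pmf p \<subseteq> A \<and> (\<forall>x\<in>A. pmf p x = w x)"
proof -
  define v where "v = (\<lambda>x. if x \<in> A then w x else 0)"
  have "(\<integral>\<^sup>+x. ennreal (v x) \<partial>count_space UNIV) = (\<Sum>x\<in>A. ennreal (v x))"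
    by (rule nn_integral_count_space'[OF assms(1)]) (auto simp: v_def)
  also have "\<dots> = ennreal (\<Sum>x\<in>A. v x)"
    using assms by (subst sum_ennreal) (auto simp: v_def)
  also have "(\<Sum>x\<in>A. v x) = 1" using assms by (simp add: v_def)
  finally have "(\<integral>\<^sup>+x. ennreal (v x) \<partial>count_space UNIV) = 1" by simp
  moreover have "\<And>x. 0 \<le> v x" using assms by (simp add: v_def)
  ultimately have "pmf (embed_pmf v) x = v x" "set_pmf (embed_pmf v) = {x. v x \<noteq> 0}" for x
    by (simp_all add: pmf_embed_pmf set_embed_pmf)
  then show ?thesis by (intro exI[of _ "embed_pmf v"]) (auto simp: v_def split: if_splits)
qed

text \<open>A linear function has the same expectation under both distributions, and passing from it
  to \<open>f\<close> costs at most \<open>\<Delta>\<close> on each side.\<close>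

lemma delta_linear_balanced_le:
  assumes U: "finite U" and lin: "delta_linear U \<Delta> f" and bal: "balanced U p q"
  shows "measure_pmf.expectation p f - measure_pmf.expectation q f \<le> 2 * \<Delta>"
proof -
  have p: "set_pmf p \<subseteq> Pow U" and q: "set_pmf q \<subseteq> Pow U"
    using bal by (auto simp: balanced_def)
  obtain l c0 c where l: "\<And>S. S \<subseteq> U \<Longrightarrow> l S = c0 + (\<Sum>i\<in>S. c i)"
    and d: "\<And>S. S \<subseteq> U \<Longrightarrow> \<bar>f S - l S\<bar> \<le> \<Delta>"
    using lin unfolding delta_linear_def linear_set_fun_def by metis
  have E: "(\<Sum>S\<in>Pow U. pmf r S * l S) = c0 + (\<Sum>i\<in>U. c i * measure_pmf.prob r {S. i \<in> S})"
    if r: "set_pmf r \<subseteq> Pow U" for r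
  proof -
    have "(\<Sum>S\<in>Pow U. pmf r S * l S)
        = (\<Sum>S\<in>Pow U. pmf r S * c0 + (\<Sum>i\<in>U. c i * (pmf r S * of_bool (i \<in> S))))"
    proof (intro sum.cong refl)
      fix S assume "S \<in> Pow U"
      then have "(\<Sum>i\<in>S. c i) = (\<Sum>i\<in>U. c i * of_bool (i \<in> S))"
        using U by (intro sum.mono_neutral_cong_left) auto
      then show "pmf r S * l S = pmf r S * c0 + (\<Sum>i\<in>U. c i * (pmf r S * of_bool (i \<in> S)))"
        using l[of S] \<open>S \<in> Pow U\<close>
        by (simp add: algebra_simps sum_distrib_left del: sum_of_bool_mult_eq sum_mult_of_bool_eq)
    qed
    also have "\<dots> = c0 + (\<Sum>S\<in>Pow U. \<Sum>i\<in>U. c i * (pmf r S * of_bool (i \<in> S)))"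
      unfolding sum.distrib sum_distrib_right[symmetric] sum_pmf_Pow[OF U r] mult_1 ..
    also have "\<dots> = c0 + (\<Sum>i\<in>U. c i * measure_pmf.prob r {S. i \<in> S})"
      by (subst sum.swap) (simp only: prob_pmf_Pow[OF U r] sum_distrib_left)
    finally show ?thesis .
  qed
  have "(\<Sum>S\<in>Pow U. pmf p S * l S) = (\<Sum>S\<in>Pow U. pmf q S * l S)"
    unfolding E[OF p] E[OF q] using bal by (auto simp: balanced_def)
  moreover have "f S \<le> l S + \<Delta>" "l S - \<Delta> \<le> f S" if "S \<in> Pow U" for S
    using d[of S] that by auto
  then have "(\<Sum>S\<in>Pow U. pmf p S * f S) \<le> (\<Sum>S\<in>Pow U. pmf p S * (l S + \<Delta>))"
    and "(\<Sum>S\<in>Pow U. pmf q S * (l S - \<Delta>)) \<le> (\<Sum>S\<in>Pow U. pmf q S * f S)"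
    by (auto intro!: sum_mono mult_left_mono)
  ultimately show ?thesis
    using sum_pmf_Pow[OF U p] sum_pmf_Pow[OF U q]
    unfolding expectation_pmf_Pow[OF U p] expectation_pmf_Pow[OF U q]
    by (simp add: distrib_left right_diff_distrib sum.distrib sum_subtractf flip: sum_distrib_right)
qed

text \<open>The unknowns are \<open>c0\<close>, with index \<open>None\<close>, and \<open>c i\<close>, with index \<open>Some i\<close>.\<close>
lemma delta_linear_dual:
  assumes U: "finite U"
    and bal: "\<And>p q. balanced U p q \<Longrightarrow>
      measure_pmf.expectation p f - measure_pmf.expectation q f \<le> 2 * \<Delta>"
  shows "delta_linear U \<Delta> f"
proof -
  define row :: "'a set \<Rightarrow> 'a option \<Rightarrow> real" where
    "row = (\<lambda>S k. case k of None \<Rightarrow> 1 | Some i \<Rightarrow> of_bool (i \<in> S))"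
  \<comment> \<open>The two families say \<open>l S \<le> f S + \<Delta>\<close> and
    \<open>- l S \<le> \<Delta> - f S\<close> for the unknown linear function
    \<open>l\<close>.\<close>
  define Q where "Q = (\<lambda>S. (row S, f S + \<Delta>)) ` Pow U \<union> (\<lambda>S. (\<lambda>k. - row S k, \<Delta> - f S)) ` Pow U"
  define I where "I = insert None (Some ` U)"
  have fin: "finite I" "finite Q" using U by (auto simp: I_def Q_def)
  have weights: "\<exists>u v. (\<forall>S. 0 \<le> u S \<and> 0 \<le> v S) \<and> (\<forall>k. fst z k = (\<Sum>S\<in>Pow U. (u S - v S) * row S k)) \<and>
      snd z = (\<Sum>S\<in>Pow U. u S * (f S + \<Delta>) + v S * (\<Delta> - f S))" if "z \<in> nonneg_comb Q" for z
    using that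
  proof (induction rule: nonneg_comb.induct)
    case (base z)
    then consider (P) S where "S \<in> Pow U" "z = (row S, f S + \<Delta>)"
      | (N) S where "S \<in> Pow U" "z = (\<lambda>k. - row S k, \<Delta> - f S)"
      unfolding Q_def by blast
    then show ?case
    proof cases
      case P
      then show ?thesis using U
        by (intro exI[of _ "\<lambda>T. of_bool (T = S)"] exI[of _ "\<lambda>T. 0"])
           (simp add: of_bool_def if_distrib[where f = "\<lambda>x. x * _"] cong: if_cong)
    next
      case N
      then show ?thesis using U
        by (intro exI[of _ "\<lambda>T. of_bool (T = S)"] exI[of _ "\<lambda>T. 0"] exI[of _ "\<lambda>T. of_bool (T = S)"])
           (simp add: of_bool_def if_distrib[where f = "\<lambda>x. x * _"] if_distrib[where f = uminus] cong: if_cong)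
    qed
  next
    case (add a b a' b')
    then obtain u v u' v' where
      "\<forall>S. 0 \<le> u S \<and> 0 \<le> v S" "\<forall>k. a k = (\<Sum>S\<in>Pow U. (u S - v S) * row S k)"
      "b = (\<Sum>S\<in>Pow U. u S * (f S + \<Delta>) + v S * (\<Delta> - f S))"
      "\<forall>S. 0 \<le> u' S \<and> 0 \<le> v' S" "\<forall>k. a' k = (\<Sum>S\<in>Pow U. (u' S - v' S) * row S k)"
      "b' = (\<Sum>S\<in>Pow U. u' S * (f S + \<Delta>) + v' S * (\<Delta> - f S))"
      by auto
    then show ?case
      by (intro exI[of _ "\<lambda>S. u S + u' S"] exI[of _ "\<lambda>S. v S + v' S"])
         (auto simp: algebra_simps simp flip: sum.distrib)
  next
    case (scale a b c)
    then obtain u v where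
      "\<forall>S. 0 \<le> u S \<and> 0 \<le> v S" "\<forall>k. a k = (\<Sum>S\<in>Pow U. (u S - v S) * row S k)"
      "b = (\<Sum>S\<in>Pow U. u S * (f S + \<Delta>) + v S * (\<Delta> - f S))"
      by auto
    then show ?case using scale.hyps
      by (intro exI[of _ "\<lambda>S. c * u S"] exI[of _ "\<lambda>S. c * v S"])
         (auto simp: algebra_simps sum_distrib_left)
  qed
  have "\<exists>x. \<forall>(a, b)\<in>Q. (\<Sum>k\<in>I. a k * x k) \<le> b"
  proof (rule farkas[OF fin])
    fix a b assume ab: "(a, b) \<in> nonneg_comb Q" and a0: "\<forall>k\<in>I. a k = 0"
    obtain u v where nn: "\<And>S. 0 \<le> u S" "\<And>S. 0 \<le> v S"
      and a: "\<And>k. a k = (\<Sum>S\<in>Pow U. (u S - v S) * row S k)"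
      and b: "b = (\<Sum>S\<in>Pow U. u S * (f S + \<Delta>) + v S * (\<Delta> - f S))"
      using weights[OF ab] by auto
    define m where "m = sum u (Pow U)"
    \<comment> \<open>The coefficient at \<open>None\<close> forces equal total masses and those at
      \<open>Some i\<close> equal marginals, so division by \<open>m\<close> yields a balanced pair.
      Here \<open>p\<close> comes from \<open>v\<close>, whose rows carry \<open>- f S\<close>, and
      \<open>q\<close> from \<open>u\<close>.\<close>
    have mv: "m = sum v (Pow U)"
      using a[of None] a0 by (simp add: I_def row_def sum_subtractf m_def)
    have marg: "(\<Sum>S\<in>Pow U. u S * of_bool (i \<in> S)) = (\<Sum>S\<in>Pow U. v S * of_bool (i \<in> S))" if "i \<in> U" for i
      using a[of "Some i"] a0 that
      by (simp add: I_def row_def sum_subtractf left_diff_distrib del: sum_of_bool_mult_eq sum_mult_of_bool_eq)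
    show "0 \<le> b"
    proof (cases "m = 0")
      case True
      then have "\<forall>S\<in>Pow U. u S = 0" "\<forall>S\<in>Pow U. v S = 0"
        using nn mv U by (simp_all add: m_def sum_nonneg_eq_0_iff)
      then show ?thesis by (simp add: b)
    next
      case False
      then have m: "m > 0" using nn by (simp add: m_def sum_nonneg less_le)
      have "\<exists>p. set_pmf p \<subseteq> Pow U \<and> (\<forall>S\<in>Pow U. pmf p S = v S / m)"
        using U nn m mv by (intro ex_pmf_of_weights) (simp_all flip: sum_divide_distrib)
      then obtain p where p: "set_pmf p \<subseteq> Pow U" "\<And>S. S \<in> Pow U \<Longrightarrow> pmf p S = v S / m" by auto
      have "\<exists>q. set_pmf q \<subseteq> Pow U \<and> (\<forall>S\<in>Pow U. pmf q S = u S / m)"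
        using U nn m m_def by (intro ex_pmf_of_weights) (simp_all flip: sum_divide_distrib)
      then obtain q where q: "set_pmf q \<subseteq> Pow U" "\<And>S. S \<in> Pow U \<Longrightarrow> pmf q S = u S / m" by auto
      have E: "measure_pmf.expectation p f = (\<Sum>S\<in>Pow U. v S * f S) / m"
              "measure_pmf.expectation q f = (\<Sum>S\<in>Pow U. u S * f S) / m"
        using p q by (simp_all add: expectation_pmf_Pow[OF U] sum_divide_distrib)
      have "balanced U p q"
        unfolding balanced_def
      proof (intro conjI ballI p q)
        fix i assume i: "i \<in> U"
        have "measure_pmf.prob p {S. i \<in> S} = (\<Sum>S\<in>Pow U. v S * of_bool (i \<in> S)) / m"
          using p by (simp add: prob_pmf_Pow[OF U] sum_divide_distrib del: sum_of_bool_mult_eq sum_mult_of_bool_eq)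
        moreover have "measure_pmf.prob q {S. i \<in> S} = (\<Sum>S\<in>Pow U. u S * of_bool (i \<in> S)) / m"
          using q by (simp add: prob_pmf_Pow[OF U] sum_divide_distrib del: sum_of_bool_mult_eq sum_mult_of_bool_eq)
        ultimately show "measure_pmf.prob p {S. i \<in> S} = measure_pmf.prob q {S. i \<in> S}"
          using marg[OF i] by simp
      qed
      from bal[OF this] have "(\<Sum>S\<in>Pow U. v S * f S) - (\<Sum>S\<in>Pow U. u S * f S) \<le> 2 * \<Delta> * m"
        using m by (simp add: E field_simps)
      moreover have "b = (\<Sum>S\<in>Pow U. u S * f S) - (\<Sum>S\<in>Pow U. v S * f S) + 2 * \<Delta> * m"
        using mv unfolding b
        by (simp add: distrib_left right_diff_distrib sum.distrib sum_subtractf m_def flip: sum_distrib_right)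
      ultimately show ?thesis by simp
    qed
  qed
  then obtain x where x: "\<And>a b. (a, b) \<in> Q \<Longrightarrow> (\<Sum>k\<in>I. a k * x k) \<le> b" by fast
  define l where "l = (\<lambda>S. x None + (\<Sum>i\<in>S. x (Some i)))"
  have row: "(\<Sum>k\<in>I. row S k * x k) = l S" if "S \<subseteq> U" for S
  proof -
    have "(\<Sum>k\<in>I. row S k * x k) = x None + (\<Sum>i\<in>U. of_bool (i \<in> S) * x (Some i))"
      using U by (simp add: I_def row_def sum.reindex del: sum_of_bool_mult_eq sum_mult_of_bool_eq)
    also have "(\<Sum>i\<in>U. of_bool (i \<in> S) * x (Some i)) = (\<Sum>i\<in>S. x (Some i))"
      using U that by (intro sum.mono_neutral_cong_right) auto
    finally show ?thesis by (simp add: l_def)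
  qed
  have "\<bar>f S - l S\<bar> \<le> \<Delta>" if S: "S \<subseteq> U" for S
  proof -
    have "(row S, f S + \<Delta>) \<in> Q" "(\<lambda>k. - row S k, \<Delta> - f S) \<in> Q"
      using S by (auto simp: Q_def)
    from this[THEN x] show ?thesis using row[OF S] by (simp add: sum_negf)
  qed
  then show ?thesis
    unfolding delta_linear_def linear_set_fun_def by (intro exI[of _ l]) (auto simp: l_def)
qed

text \<open>For each balanced pair the dual condition is a non-strict inequality in
  \<open>\<Delta>\<close> and survives the limit. This replaces a compactness argument on the
  coefficients of the linear functions.\<close>

lemma delta_linear_closed:
  assumes "finite U" "\<And>\<Delta>'. \<Delta>' > \<Delta> \<Longrightarrow> delta_linear U \<Delta>' f"
  shows "delta_linear U \<Delta> f"
proof (rule delta_linear_dual[OF assms(1)])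
  fix p q assume "balanced U p q"
  then have "measure_pmf.expectation p f - measure_pmf.expectation q f \<le> 2 * \<Delta>'" if "\<Delta>' > \<Delta>" for \<Delta>'
    using delta_linear_balanced_le assms that by blast
  note le = this
  show "measure_pmf.expectation p f - measure_pmf.expectation q f \<le> 2 * \<Delta>"
  proof (rule field_le_epsilon)
    fix e :: real assume "e > 0"
    then have "measure_pmf.expectation p f - measure_pmf.expectation q f \<le> 2 * (\<Delta> + e / 2)"
      by (intro le) simp
    then show "measure_pmf.expectation p f - measure_pmf.expectation q f \<le> 2 * \<Delta> + e"
      by (simp only: distrib_left)
  qed
qed

lemma delta_linear_mono: "delta_linear U \<Delta> f \<Longrightarrow> \<Delta> \<le> \<Delta>' \<Longrightarrow> delta_linear U \<Delta>' f"
  unfolding delta_linear_def by (meson order_trans)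

subsection \<open>Peeling on the biregular tree\<close>

text \<open>Messages of the peeling process on the tree, as functions of the item: the round by which a set no
  longer needs a host (0 if it does not contain the item), and the round by which a host is free
  for a set, because its other three sets no longer need it. A set takes the item to the first of its
  three hosts that becomes free. Hosts have colours \<open>j < 3\<close>, each set has one host of each
  colour, and a host of colour \<open>j\<close> uses only rounds congruent to \<open>j + 1\<close> modulo 3, which rules out ties.
  In \<open>set_law \<nu> T j\<close>, the law of messages from a set to its host of colour \<open>j\<close>,
  the value \<open>T\<close> means ``at least \<open>T\<close>''.\<close>

definition host_msg :: "nat \<Rightarrow> ('a \<Rightarrow> nat) \<Rightarrow> ('a \<Rightarrow> nat) \<Rightarrow> ('a \<Rightarrow> nat) \<Rightarrow> 'a \<Rightarrow> nat" where
  "host_msg j a b c = (\<lambda>i. 3 * max (a i) (max (b i) (c i)) + j + 1)"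

definition set_msg :: "nat \<Rightarrow> 'a set \<Rightarrow> ('a \<Rightarrow> nat) \<Rightarrow> ('a \<Rightarrow> nat) \<Rightarrow> 'a \<Rightarrow> nat" where
  "set_msg T S b c = (\<lambda>i. if i \<in> S then min T (min (b i) (c i)) else 0)"

definition host_law :: "nat \<Rightarrow> ('a \<Rightarrow> nat) pmf \<Rightarrow> ('a \<Rightarrow> nat) pmf" where
  "host_law j p = map_pmf (\<lambda>(a, b, c). host_msg j a b c) (pair_pmf p (pair_pmf p p))"

primrec set_law :: "'a set pmf \<Rightarrow> nat \<Rightarrow> nat \<Rightarrow> ('a \<Rightarrow> nat) pmf" where
  "set_law \<nu> 0 j = return_pmf (\<lambda>_. 0)"
| "set_law \<nu> (Suc T) j = map_pmf (\<lambda>(S, b, c). set_msg (Suc T) S b c)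
     (pair_pmf \<nu> (pair_pmf (host_law ((j + 1) mod 3) (set_law \<nu> T ((j + 1) mod 3)))
                             (host_law ((j + 2) mod 3) (set_law \<nu> T ((j + 2) mod 3)))))"

abbreviation trunc :: "nat \<Rightarrow> ('a \<Rightarrow> nat) \<Rightarrow> 'a \<Rightarrow> nat" where
  "trunc T a \<equiv> (\<lambda>i. min T (a i))"

text \<open>With \<open>a\<close> the message from a set to a host and \<open>b\<close> the message
  back, an item crosses the edge if this host is free strictly before the set is served elsewhere.
  Items outside the set have \<open>a i = 0\<close> and never cross.\<close>

definition piece :: "('a \<Rightarrow> nat) \<Rightarrow> ('a \<Rightarrow> nat) \<Rightarrow> 'a set" where
  "piece a b = {i. b i < a i}"

section \<open>Consistency of the message laws under truncation\<close>

lemma pair_map_pmf3: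
  "pair_pmf (map_pmf f p) (pair_pmf (map_pmf g q) (map_pmf h r)) =
     map_pmf (\<lambda>(a, b, c). (f a, g b, h c)) (pair_pmf p (pair_pmf q r))"
  by (simp add: pair_pmf_def map_pmf_def bind_assoc_pmf bind_return_pmf)

text \<open>A host message exceeds each of its inputs, so truncating the inputs at \<open>T\<close>
  can change only outputs that are at least \<open>Suc T\<close> anyway.\<close>

lemma host_law_trunc:
  "map_pmf (trunc (Suc T)) (host_law j (map_pmf (trunc T) p)) = map_pmf (trunc (Suc T)) (host_law j p)"
proof -
  have "max (min T x) (max (min T y) (min T z)) = min T (max x (max y z))" for x y z :: nat
    by (simp add: min_max_distrib2)
  moreover have "min (Suc T) (3 * min T m + j + 1) = min (Suc T) (3 * m + j + 1)" for m :: nat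
    by (simp add: min_def)
  ultimately show ?thesis
    unfolding host_law_def pair_map_pmf3 map_pmf_comp
    by (intro map_pmf_cong refl) (simp only: host_msg_def case_prod_unfold fst_conv snd_conv)
qed

text \<open>The laws of different depths form a projective family: a deeper computation refines only
  the value \<open>T\<close>. This lets finite depths stand in for the infinite tree.\<close>

lemma set_law_trunc: "map_pmf (trunc T) (set_law \<nu> (Suc T) j) = set_law \<nu> T j"
proof (induction T arbitrary: j)
  case 0
  then show ?case by (simp add: map_pmf_comp case_prod_unfold)
next
  case (Suc T)
  let ?k = "(j + 1) mod 3" and ?l = "(j + 2) mod 3"
  define p where "p = host_law ?k (set_law \<nu> (Suc T) ?k)"
  define q where "q = host_law ?l (set_law \<nu> (Suc T) ?l)"
  define p' where "p' = host_law ?k (set_law \<nu> T ?k)"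
  define q' where "q' = host_law ?l (set_law \<nu> T ?l)"
  have eq: "map_pmf (trunc (Suc T)) p = map_pmf (trunc (Suc T)) p'"
           "map_pmf (trunc (Suc T)) q = map_pmf (trunc (Suc T)) q'"
    unfolding p_def p'_def q_def q'_def Suc.IH[of ?k, symmetric] Suc.IH[of ?l, symmetric]
    by (rule host_law_trunc[symmetric])+
  have "map_pmf (trunc (Suc T)) (set_law \<nu> (Suc (Suc T)) j)
      = map_pmf (\<lambda>(S, b, c). trunc (Suc T) (set_msg (Suc (Suc T)) S b c)) (pair_pmf \<nu> (pair_pmf p q))"
    by (simp add: map_pmf_comp case_prod_unfold p_def q_def del: set_law.simps add: set_law.simps(2)[of _ "Suc T"])
  also have "\<dots> = map_pmf (\<lambda>(S, b, c). set_msg (Suc T) S b c)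
      (pair_pmf (map_pmf id \<nu>) (pair_pmf (map_pmf (trunc (Suc T)) p) (map_pmf (trunc (Suc T)) q)))"
    unfolding pair_map_pmf3 map_pmf_comp
    by (intro map_pmf_cong refl) (auto simp: set_msg_def fun_eq_iff min_def)
  also have "\<dots> = map_pmf (\<lambda>(S, b, c). set_msg (Suc T) S b c) (pair_pmf \<nu> (pair_pmf p' q'))"
    unfolding eq pair_map_pmf3 map_pmf_comp
    by (intro map_pmf_cong refl) (auto simp: set_msg_def fun_eq_iff min_def)
  finally show ?case by (simp add: p'_def q'_def)
qed

lemma set_law_trunc_le: "r \<le> T \<Longrightarrow> map_pmf (trunc r) (set_law \<nu> T j) = set_law \<nu> r j"
proof (induction T rule: dec_induct)
  case base
  have "map_pmf (trunc r) (map_pmf (trunc r) (set_law \<nu> (Suc r) j)) = map_pmf (trunc r) (set_law \<nu> (Suc r) j)"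
    by (simp add: map_pmf_comp)
  then show ?case by (simp only: set_law_trunc)
next
  case (step T)
  have "map_pmf (trunc r) (map_pmf (trunc T) (set_law \<nu> (Suc T) j)) = map_pmf (trunc r) (set_law \<nu> (Suc T) j)"
    using step.hyps by (simp add: map_pmf_comp min.assoc[symmetric] min_absorb1)
  then show ?case using step.IH by (simp only: set_law_trunc)
qed

lemma finite_host_law: "finite (set_pmf p) \<Longrightarrow> finite (set_pmf (host_law j p))"
  by (simp add: host_law_def)

lemma finite_set_law: "finite (set_pmf \<nu>) \<Longrightarrow> finite (set_pmf (set_law \<nu> T j))"
  by (induction T arbitrary: j) (simp_all add: finite_host_law)

lemma set_law_le: "a \<in> set_pmf (set_law \<nu> T j) \<Longrightarrow> a i \<le> T"
  by (cases T) (auto simp: set_msg_def)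

lemma set_law_support: "a \<in> set_pmf (set_law \<nu> T j) \<Longrightarrow> set_pmf \<nu> \<subseteq> Pow U \<Longrightarrow> i \<notin> U \<Longrightarrow> a i = 0"
  by (cases T) (auto simp: set_msg_def subset_iff)

lemma host_law_mod: "b \<in> set_pmf (host_law j p) \<Longrightarrow> b i mod 3 = (j + 1) mod 3"
  by (auto simp: host_law_def host_msg_def add.assoc)

text \<open>The pieces have the same law seen from a set (left) and from a host (right).\<close>
lemma expectation_piece_host_law:
  fixes g :: "'a set \<Rightarrow> real"
  shows "measure_pmf.expectation (pair_pmf (set_law \<nu> (Suc T) j) (host_law j (set_law \<nu> T j))) (\<lambda>(a, b). g (piece a b))
    = measure_pmf.expectation (pair_pmf (set_law \<nu> (Suc T) j) (host_law j (set_law \<nu> (Suc T) j))) (\<lambda>(a, b). g (piece a b))"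
    (is "?lhs = ?rhs")
proof -
  let ?p = "set_law \<nu> (Suc T) j"
  \<comment> \<open>Set messages are at most \<open>Suc T\<close>, so capping the host message there
    does not affect the strict comparison in \<open>piece\<close>.\<close>
  have E: "map_pmf (\<lambda>(a, b). piece a b) (pair_pmf ?p q)
      = map_pmf (\<lambda>(a, b). piece a b) (pair_pmf ?p (map_pmf (trunc (Suc T)) q))" for q
    unfolding pair_map_pmf2 map_pmf_comp
  proof (intro map_pmf_cong refl)
    fix z assume "z \<in> set_pmf (pair_pmf ?p q)"
    then have "fst z i \<le> Suc T" for i
      by (auto simp del: set_law.simps intro: set_law_le)
    from leD[OF this] show "(\<lambda>(a, b). piece a b) z = (\<lambda>(a, b). piece a b) (apsnd (trunc (Suc T)) z)"
      by (auto simp: piece_def case_prod_unfold min_less_iff_disj)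
  qed
  have "host_law j (set_law \<nu> T j) = host_law j (map_pmf (trunc T) ?p)"
    by (simp only: set_law_trunc)
  then have "map_pmf (\<lambda>(a, b). piece a b) (pair_pmf ?p (host_law j (set_law \<nu> T j)))
      = map_pmf (\<lambda>(a, b). piece a b) (pair_pmf ?p (host_law j ?p))"
    using E host_law_trunc by metis
  then have "measure_pmf.expectation (map_pmf (\<lambda>(a, b). piece a b) (pair_pmf ?p (host_law j (set_law \<nu> T j)))) g
      = measure_pmf.expectation (map_pmf (\<lambda>(a, b). piece a b) (pair_pmf ?p (host_law j ?p))) g"
    by simp
  then show ?thesis by (simp only: integral_map_pmf case_prod_unfold)
qed

text \<open>The message of a set to one host depends only on the set and the other two hosts, hence
  is independent of what that host sends. The three equations record this for the three edges at a
  set.\<close>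

lemma pair_pmf_reorder:
  "map_pmf (\<lambda>(s, a, b, c). (r s b c, a)) (pair_pmf s (pair_pmf a (pair_pmf b c)))
     = pair_pmf (map_pmf (\<lambda>(s, b, c). r s b c) (pair_pmf s (pair_pmf b c))) a"
  "map_pmf (\<lambda>(s, a, b, c). (r s c a, b)) (pair_pmf s (pair_pmf a (pair_pmf b c)))
     = pair_pmf (map_pmf (\<lambda>(s, c, a). r s c a) (pair_pmf s (pair_pmf c a))) b"
  "map_pmf (\<lambda>(s, a, b, c). (r s a b, c)) (pair_pmf s (pair_pmf a (pair_pmf b c)))
     = pair_pmf (map_pmf (\<lambda>(s, a, b). r s a b) (pair_pmf s (pair_pmf a b))) c"
  subgoal
    apply (simp add: pair_pmf_def map_pmf_def bind_assoc_pmf bind_return_pmf)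
    apply (subst bind_commute_pmf[of a b])
    apply (subst bind_commute_pmf[of a c])
    apply (rule refl)
    done
  subgoal
    apply (simp add: pair_pmf_def map_pmf_def bind_assoc_pmf bind_return_pmf)
    apply (subst bind_commute_pmf[of b c])
    apply (subst bind_commute_pmf[of a c])
    apply (rule refl)
    done
  subgoal
    by (simp add: pair_pmf_def map_pmf_def bind_assoc_pmf bind_return_pmf)
  done

section \<open>Probability bounds for late messages\<close>

lemma prob_pair_pmf_Times:
  "measure_pmf.prob (pair_pmf p q) {(x, y). P x \<and> Q y} = measure_pmf.prob p {x. P x} * measure_pmf.prob q {y. Q y}"
proof -
  have "measure_pmf.prob (pair_pmf p q) {(x, y). P x \<and> Q y}
      = measure_pmf.prob (map_pmf (\<lambda>(x, y). (P x, Q y)) (pair_pmf p q)) {(True, True)}"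
    by (subst measure_map_pmf) (auto intro!: arg_cong[where f = "measure_pmf.prob _"])
  also have "\<dots> = pmf (map_pmf P p) True * pmf (map_pmf Q q) True"
    by (simp add: map_pair measure_pmf_single pmf_pair)
  also have "\<dots> = measure_pmf.prob p {x. P x} * measure_pmf.prob q {y. Q y}"
    by (simp add: pmf_map vimage_def)
  finally show ?thesis .
qed

text \<open>If the three independent inputs are all below \<open>T\<close>, the output is at most
  \<open>3 * (T - 1) + k + 1\<close>, which is below \<open>3 * T + 3\<close> as
  \<open>k < 3\<close>.\<close>

lemma prob_host_law_ge:
  assumes "k < 3"
  shows "measure_pmf.prob (host_law k p) {b. b i \<ge> 3 * T + 3} \<le> 1 - (1 - measure_pmf.prob p {a. a i \<ge> T}) ^ 3"
proof -
  have c: "measure_pmf.prob p {a. a i < T} = 1 - measure_pmf.prob p {a. a i \<ge> T}"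
    by (subst measure_pmf.prob_compl[symmetric]) (auto intro!: arg_cong[where f = "measure_pmf.prob _"])
  have "measure_pmf.prob (pair_pmf p (pair_pmf p p)) {(x, y). x i < T \<and> (case y of (x, y) \<Rightarrow> x i < T \<and> y i < T)}
      = (1 - measure_pmf.prob p {a. a i \<ge> T}) ^ 3"
    unfolding prob_pair_pmf_Times c power3_eq_cube by simp
  moreover have "measure_pmf.prob (host_law k p) {b. b i < 3 * T + 3}
      \<ge> measure_pmf.prob (pair_pmf p (pair_pmf p p)) {(x, y). x i < T \<and> (case y of (x, y) \<Rightarrow> x i < T \<and> y i < T)}"
    unfolding host_law_def measure_map_pmf
    using assms by (intro measure_pmf.finite_measure_mono) (auto simp: host_msg_def)
  moreover have "measure_pmf.prob (host_law k p) {b. b i \<ge> 3 * T + 3} = 1 - measure_pmf.prob (host_law k p) {b. b i < 3 * T + 3}"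
    by (subst measure_pmf.prob_compl[symmetric]) (auto intro!: arg_cong[where f = "measure_pmf.prob _"])
  ultimately show ?thesis by simp
qed

lemma expectation_pmf_mono:
  fixes f g :: "'b \<Rightarrow> real"
  assumes "finite (set_pmf p)" "\<And>x. x \<in> set_pmf p \<Longrightarrow> f x \<le> g x"
  shows "measure_pmf.expectation p f \<le> measure_pmf.expectation p g"
  using assms by (intro integral_mono_AE integrable_measure_pmf_finite) (auto simp: AE_measure_pmf_iff)

lemma rotate_pair_pmf:
  "map_pmf (\<lambda>(a, b, c, d). (b, c, d, a)) (pair_pmf p (pair_pmf q (pair_pmf r s)))
     = pair_pmf q (pair_pmf r (pair_pmf s p))"
  apply (simp add: pair_pmf_def map_pmf_def bind_assoc_pmf bind_return_pmf)
  apply (subst bind_commute_pmf[of p q])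
  apply (subst bind_commute_pmf[of p r])
  apply (subst bind_commute_pmf[of p s])
  apply (rule refl)
  done

text \<open>The bound \<open>x (3 - 5 x / 2)\<^sup>2 \<le> 8 / 5\<close> used here is equivalent to
  \<open>(4 - y) (1 - y)\<^sup>2 \<ge> 0\<close> for \<open>y = 5 x / 2\<close>.\<close>
lemma half_cube_le:
  fixes x :: real
  assumes "0 \<le> x" "x \<le> 1 / 2"
  shows "1 / 2 * (1 - (1 - x) ^ 3) ^ 2 \<le> 4 / 5 * x"
proof -
  have "1 - (1 - x) ^ 3 = x * (3 - 3 * x + x ^ 2)" by (simp add: algebra_simps power2_eq_square power3_eq_cube)
  also have "\<dots> \<le> x * (3 - 5 / 2 * x)"
  proof (rule mult_left_mono)
    have "x * x \<le> 1 / 2 * x" using assms by (intro mult_right_mono) auto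
    then show "3 - 3 * x + x ^ 2 \<le> 3 - 5 / 2 * x" by (simp add: power2_eq_square)
  qed (use assms in auto)
  finally have "(1 - (1 - x) ^ 3) ^ 2 \<le> (x * (3 - 5 / 2 * x)) ^ 2"
    using assms by (intro power_mono) (auto simp: power_le_one)
  also have "\<dots> = 2 * x * (4 / 5 - 1 / 5 * ((4 - 5 / 2 * x) * (1 - 5 / 2 * x) ^ 2))"
    by (simp add: power2_eq_square field_simps)
  also have "\<dots> \<le> 2 * x * (4 / 5)"
    using assms by (intro mult_left_mono) auto
  finally show ?thesis by simp
qed

section \<open>Counting pieces at hosts and at sets\<close>

fun level :: "nat \<Rightarrow> nat" where
  "level 0 = 0"
| "level (Suc r) = 3 * level r + 3"

text \<open>With \<open>g {} = 0\<close>, merging disjoint pieces costs \<open>\<epsilon>\<close>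
  per union. The one-sided bound \<open>M\<close> is the quantity to be improved; a two-sided bound
  enters only as a factor of an error that tends to 0.\<close>

locale half_density =
  fixes U :: "'a set" and \<nu> :: "'a set pmf" and g :: "'a set \<Rightarrow> real" and \<epsilon> M :: real
  assumes finite_U: "finite U"
    and supp: "set_pmf \<nu> \<subseteq> Pow U"
    and half: "\<And>i. i \<in> U \<Longrightarrow> measure_pmf.prob \<nu> {S. i \<in> S} = 1 / 2"
    and g_empty: "g {} = 0"
    and g_add: "\<And>S T. S \<subseteq> U \<Longrightarrow> T \<subseteq> U \<Longrightarrow> S \<inter> T = {} \<Longrightarrow> \<bar>g S + g T - g (S \<union> T)\<bar> \<le> \<epsilon>"
    and g_le: "\<And>S. S \<subseteq> U \<Longrightarrow> g S \<le> M"
begin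

lemma finite_supp: "finite (set_pmf \<nu>)"
  using supp finite_U by (meson finite_Pow_iff finite_subset)

text \<open>An item goes to the host from a set only if that set's message strictly exceeds those of
  the other three, so the four pieces are disjoint. Three unions merge them into one set with value
  at most \<open>M\<close>, and by symmetry the four pieces have equal expectations.\<close>

lemma host_view:
  assumes fin: "finite (set_pmf p)" and z: "\<And>a i. a \<in> set_pmf p \<Longrightarrow> i \<notin> U \<Longrightarrow> a i = 0"
  shows "4 * measure_pmf.expectation (pair_pmf p (host_law j p)) (\<lambda>(a, b). g (piece a b)) \<le> M + 3 * \<epsilon>"
proof -
  define W where "W = pair_pmf p (pair_pmf p (pair_pmf p p))"
  define Q where "Q = (\<lambda>a b c d. piece (a :: 'a \<Rightarrow> nat) (host_msg j b c d))"
  define e where "e = measure_pmf.expectation (pair_pmf p (host_law j p)) (\<lambda>(a, b). g (piece a b))"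
  have finW: "finite (set_pmf W)" by (simp add: W_def fin)
  have e: "measure_pmf.expectation W (\<lambda>(a, b, c, d). g (Q a b c d)) = e"
    by (simp add: e_def W_def host_law_def pair_map_pmf2 case_prod_unfold Q_def)
  have rot: "measure_pmf.expectation W (\<lambda>(a, b, c, d). h b c d a) = measure_pmf.expectation W (\<lambda>(a, b, c, d). h a b c d)"
    for h :: "('a \<Rightarrow> nat) \<Rightarrow> ('a \<Rightarrow> nat) \<Rightarrow> ('a \<Rightarrow> nat) \<Rightarrow> ('a \<Rightarrow> nat) \<Rightarrow> real"
  proof -
    have "measure_pmf.expectation W (\<lambda>(a, b, c, d). h a b c d)
        = measure_pmf.expectation (map_pmf (\<lambda>(a, b, c, d). (b, c, d, a)) W) (\<lambda>(a, b, c, d). h a b c d)"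
      unfolding W_def rotate_pair_pmf ..
    then show ?thesis by (simp add: case_prod_unfold)
  qed
  have "4 * e = measure_pmf.expectation W (\<lambda>(a, b, c, d). g (Q a b c d))
      + measure_pmf.expectation W (\<lambda>(a, b, c, d). g (Q b c d a))
      + measure_pmf.expectation W (\<lambda>(a, b, c, d). g (Q c d a b))
      + measure_pmf.expectation W (\<lambda>(a, b, c, d). g (Q d a b c))"
    using rot[of "\<lambda>a b c d. g (Q a b c d)"] rot[of "\<lambda>a b c d. g (Q b c d a)"]
      rot[of "\<lambda>a b c d. g (Q c d a b)"] e by simp
  also have "\<dots> = measure_pmf.expectation W
      (\<lambda>(a, b, c, d). g (Q a b c d) + g (Q b c d a) + g (Q c d a b) + g (Q d a b c))"
    unfolding case_prod_unfold
    by (subst Bochner_Integration.integral_add[symmetric]; (rule integrable_measure_pmf_finite[OF finW])?)+ simp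
  also have "\<dots> \<le> measure_pmf.expectation W (\<lambda>_. M + 3 * \<epsilon>)"
  proof (rule expectation_pmf_mono[OF finW])
    fix w assume w: "w \<in> set_pmf W"
    obtain a b c d where w_eq: "w = (a, b, c, d)" by (cases w)
    have abcd: "a \<in> set_pmf p" "b \<in> set_pmf p" "c \<in> set_pmf p" "d \<in> set_pmf p"
      using w by (auto simp: w_eq W_def)
    have sub: "Q x y y' y'' \<subseteq> U" if "x \<in> set_pmf p" for x y y' y''
      using z[OF that] by (force simp: Q_def piece_def)
    have "\<bar>g (Q a b c d) + g (Q b c d a) - g (Q a b c d \<union> Q b c d a)\<bar> \<le> \<epsilon>"
      using sub abcd by (intro g_add) (auto simp: Q_def piece_def host_msg_def)
    moreover have "\<bar>g (Q a b c d \<union> Q b c d a) + g (Q c d a b)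
        - g (Q a b c d \<union> Q b c d a \<union> Q c d a b)\<bar> \<le> \<epsilon>"
      using sub abcd by (intro g_add) (auto simp: Q_def piece_def host_msg_def)
    moreover have "\<bar>g (Q a b c d \<union> Q b c d a \<union> Q c d a b) + g (Q d a b c)
        - g (Q a b c d \<union> Q b c d a \<union> Q c d a b \<union> Q d a b c)\<bar> \<le> \<epsilon>"
      using sub abcd by (intro g_add) (auto simp: Q_def piece_def host_msg_def)
    moreover have "g (Q a b c d \<union> Q b c d a \<union> Q c d a b \<union> Q d a b c) \<le> M"
      using sub abcd by (intro g_le) auto
    ultimately show "(case w of (a, b, c, d) \<Rightarrow> g (Q a b c d) + g (Q b c d a) + g (Q c d a b) + g (Q d a b c))
        \<le> M + 3 * \<epsilon>"
      by (simp add: w_eq abs_le_iff)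
  qed
  finally show ?thesis by (simp add: e_def)
qed

text \<open>If every item has a free host in time, the three pieces partition the set and two unions
  suffice. Otherwise the four values involved are bounded by \<open>B\<close>, and a union bound
  over the items controls how often this happens.\<close>

lemma set_view:
  assumes B: "\<And>S. S \<subseteq> U \<Longrightarrow> \<bar>g S\<bar> \<le> B"
  shows "measure_pmf.expectation \<nu> g \<le>
    (\<Sum>j<3. measure_pmf.expectation (pair_pmf (set_law \<nu> (Suc T) j) (host_law j (set_law \<nu> T j))) (\<lambda>(a, b). g (piece a b)))
      + 2 * \<epsilon> + 4 * B * (\<Sum>i\<in>U. measure_pmf.prob (host_law 0 (set_law \<nu> T 0)) {b. Suc T \<le> b i})"
proof -
  define h where "h = (\<lambda>j. host_law j (set_law \<nu> T j))"
  define V where "V = pair_pmf \<nu> (pair_pmf (h 0) (pair_pmf (h 1) (h 2)))"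
  define Q where "Q = (\<lambda>(S :: 'a set) a b c. piece (set_msg (Suc T) S b c) a)"
  define edge where "edge = (\<lambda>j. measure_pmf.expectation (pair_pmf (set_law \<nu> (Suc T) j) (h j)) (\<lambda>(a, b). g (piece a b)))"
  have finh: "finite (set_pmf (h j))" for j
    by (simp add: h_def finite_host_law finite_set_law finite_supp)
  have finV: "finite (set_pmf V)" by (simp add: V_def finh finite_supp)
  have e0: "measure_pmf.expectation V (\<lambda>(S, a, b, c). g (Q S a b c)) = edge 0"
  proof -
    have "pair_pmf (set_law \<nu> (Suc T) 0) (h 0) = map_pmf (\<lambda>(S, a, b, c). (set_msg (Suc T) S b c, a)) V"
      unfolding V_def pair_pmf_reorder by (simp add: h_def numeral_2_eq_2)
    then show ?thesis by (simp add: edge_def case_prod_unfold Q_def)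
  qed
  have e1: "measure_pmf.expectation V (\<lambda>(S, a, b, c). g (Q S b c a)) = edge 1"
  proof -
    have "pair_pmf (set_law \<nu> (Suc T) 1) (h 1) = map_pmf (\<lambda>(S, a, b, c). (set_msg (Suc T) S c a, b)) V"
      unfolding V_def pair_pmf_reorder by (simp add: h_def numeral_2_eq_2)
    then show ?thesis by (simp add: edge_def case_prod_unfold Q_def)
  qed
  have e2: "measure_pmf.expectation V (\<lambda>(S, a, b, c). g (Q S c a b)) = edge 2"
  proof -
    have "pair_pmf (set_law \<nu> (Suc T) 2) (h 2) = map_pmf (\<lambda>(S, a, b, c). (set_msg (Suc T) S a b, c)) V"
      unfolding V_def pair_pmf_reorder by (simp add: h_def)
    then show ?thesis by (simp add: edge_def case_prod_unfold Q_def)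
  qed
  have tail: "measure_pmf.expectation V (\<lambda>(S, a, b, c). indicator {b. Suc T \<le> b i} a)
      = measure_pmf.prob (h 0) {b. Suc T \<le> b i}" for i
  proof -
    have "map_pmf (\<lambda>(S, a, b, c). a) V = map_pmf fst (map_pmf snd V)"
      by (simp add: map_pmf_comp case_prod_unfold)
    also have "\<dots> = h 0" by (simp add: V_def map_fst_pair_pmf map_snd_pair_pmf)
    finally have m: "map_pmf (\<lambda>(S, a, b, c). a) V = h 0" .
    have "measure_pmf.expectation V (\<lambda>(S, a, b, c). indicator {b. Suc T \<le> b i} a :: real)
        = measure_pmf.expectation (map_pmf (\<lambda>(S, a, b, c). a) V) (indicator {b. Suc T \<le> b i})"
      unfolding integral_map_pmf case_prod_unfold ..
    then show ?thesis unfolding m by simp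
  qed
  have lin: "measure_pmf.expectation V (\<lambda>v. X v + Y v + Z v + (k + l * (\<Sum>i\<in>U. J i v)))
      = measure_pmf.expectation V X + measure_pmf.expectation V Y + measure_pmf.expectation V Z
        + (k + l * (\<Sum>i\<in>U. measure_pmf.expectation V (J i)))"
    for X Y Z :: "_ \<Rightarrow> real" and J :: "_ \<Rightarrow> _ \<Rightarrow> real" and k l
  proof -
    have "integrable (measure_pmf V) F" for F :: "_ \<Rightarrow> real"
      by (rule integrable_measure_pmf_finite[OF finV])
    then show ?thesis by simp
  qed
  have "measure_pmf.expectation \<nu> g = measure_pmf.expectation V (\<lambda>v. g (fst v))"
    by (simp add: V_def)
  also have "\<dots> \<le> measure_pmf.expectation V (\<lambda>v.
      (\<lambda>(S, a, b, c). g (Q S a b c)) v + (\<lambda>(S, a, b, c). g (Q S b c a)) v + (\<lambda>(S, a, b, c). g (Q S c a b)) v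
      + (2 * \<epsilon> + 4 * B * (\<Sum>i\<in>U. (\<lambda>(S, a, b, c). indicator {b. Suc T \<le> b i} a) v)))"
  proof (rule expectation_pmf_mono[OF finV])
    fix v assume v: "v \<in> set_pmf V"
    obtain S a b c where v_eq: "v = (S, a, b, c)" by (cases v)
    have S: "S \<subseteq> U" using v supp by (auto simp: v_eq V_def)
    \<comment> \<open>The colours put the three host messages in different residue classes, so
      exactly one of them is smallest.\<close>
    have mods: "a i mod 3 = 1" "b i mod 3 = 2" "c i mod 3 = 0" for i
      using v host_law_mod[of a 0] host_law_mod[of b 1] host_law_mod[of c 2]
      by (auto simp: v_eq V_def h_def numeral_2_eq_2)
    let ?X = "Q S a b c" and ?Y = "Q S b c a" and ?Z = "Q S c a b"
    let ?R = "\<Sum>i\<in>U. indicator {b. Suc T \<le> b i} a :: real"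
    have R0: "?R \<ge> 0" by (intro sum_nonneg) auto
    have B0: "B \<ge> 0" using B[of "{}"] by simp
    have sub: "?X \<subseteq> S" "?Y \<subseteq> S" "?Z \<subseteq> S"
      by (auto simp: Q_def piece_def set_msg_def split: if_splits)
    have disj: "?X \<inter> ?Y = {}" "(?X \<union> ?Y) \<inter> ?Z = {}"
      by (auto simp: Q_def piece_def set_msg_def split: if_splits)
    have "g S \<le> g ?X + g ?Y + g ?Z + (2 * \<epsilon> + 4 * B * ?R)"
    proof (cases "\<exists>i\<in>U. Suc T \<le> a i")
      case True
      then have "?R \<ge> 1"
      proof -
        from True obtain i where "i \<in> U" "Suc T \<le> a i" by blast
        then have "indicator {b. Suc T \<le> b i} a \<le> ?R"
          by (intro member_le_sum finite_U) auto
        then show ?thesis using \<open>Suc T \<le> a i\<close> by simp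
      qed
      then have "4 * B \<le> 4 * B * ?R" using B0 by (simp add: mult_le_cancel_left1)
      moreover have "0 \<le> \<epsilon>" using g_add[of "{}" "{}"] by (simp add: g_empty)
      moreover have "\<bar>g S\<bar> \<le> B" "\<bar>g ?X\<bar> \<le> B" "\<bar>g ?Y\<bar> \<le> B" "\<bar>g ?Z\<bar> \<le> B"
        using S sub by (auto intro!: B)
      ultimately show ?thesis by (simp add: abs_le_iff)
    next
      case False
      \<comment> \<open>The host of colour 0 is free by round \<open>T\<close>, so the smallest host
        message is below the cap \<open>Suc T\<close> of the set messages.\<close>
      have "S \<subseteq> ?X \<union> ?Y \<union> ?Z"
      proof
        fix i assume i: "i \<in> S"
        then have "a i \<le> T" using False S by (auto simp: not_less_eq_eq)
        moreover have "a i \<noteq> b i" "b i \<noteq> c i" "a i \<noteq> c i"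
          using mods[of i] by auto
        ultimately show "i \<in> ?X \<union> ?Y \<union> ?Z"
          using i by (auto simp: Q_def piece_def set_msg_def)
      qed
      then have "?X \<union> ?Y \<union> ?Z = S" using sub by blast
      moreover have "\<bar>g ?X + g ?Y - g (?X \<union> ?Y)\<bar> \<le> \<epsilon>"
        using S sub disj by (intro g_add) auto
      moreover have "\<bar>g (?X \<union> ?Y) + g ?Z - g (?X \<union> ?Y \<union> ?Z)\<bar> \<le> \<epsilon>"
        using S sub disj by (intro g_add) auto
      moreover have "0 \<le> 4 * B * ?R" using R0 B0 by simp
      ultimately show ?thesis by (simp only: abs_le_iff) linarith
    qed
    then show "g (fst v) \<le> (\<lambda>(S, a, b, c). g (Q S a b c)) v + (\<lambda>(S, a, b, c). g (Q S b c a)) v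
        + (\<lambda>(S, a, b, c). g (Q S c a b)) v
        + (2 * \<epsilon> + 4 * B * (\<Sum>i\<in>U. (\<lambda>(S, a, b, c). indicator {b. Suc T \<le> b i} a) v))"
      by (simp add: v_eq)
  qed
  also have "\<dots> = edge 0 + edge 1 + edge 2 + (2 * \<epsilon> + 4 * B * (\<Sum>i\<in>U. measure_pmf.prob (h 0) {b. Suc T \<le> b i}))"
    unfolding e0[symmetric] e1[symmetric] e2[symmetric] tail[symmetric]
    by (rule lin)
  finally have "measure_pmf.expectation \<nu> g \<le> edge 0 + edge 1 + edge 2
      + (2 * \<epsilon> + 4 * B * (\<Sum>i\<in>U. measure_pmf.prob (h 0) {b. Suc T \<le> b i}))" .
  moreover have "(\<Sum>j<3. edge j) = edge 0 + edge 1 + edge 2"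
    by (simp add: numeral_3_eq_3 numeral_2_eq_2)
  ultimately show ?thesis unfolding edge_def h_def by linarith
qed

text \<open>An item is still pending if it lies in the set, which has probability 1/2, and both
  other hosts are late; the three events are independent. Truncation reduces the messages of depth
  \<open>3 * T + 2\<close> to those of depth \<open>T\<close>.\<close>

lemma prob_set_law_step:
  assumes i: "i \<in> U" and X: "\<And>k. k < 3 \<Longrightarrow> measure_pmf.prob (set_law \<nu> T k) {a. T \<le> a i} \<le> X" and X1: "X \<le> 1"
  shows "measure_pmf.prob (set_law \<nu> (3 * T + 3) j) {a. 3 * T + 3 \<le> a i} \<le> 1 / 2 * (1 - (1 - X) ^ 3) ^ 2"
proof -
  let ?k = "(j + 1) mod 3" and ?l = "(j + 2) mod 3"
  define h where "h = (\<lambda>k. host_law k (set_law \<nu> (3 * T + 2) k))"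
  have hle: "measure_pmf.prob (h k) {b. 3 * T + 3 \<le> b i} \<le> 1 - (1 - X) ^ 3" if k: "k < 3" for k
  proof -
    have "measure_pmf.prob (set_law \<nu> T k) {a. T \<le> a i}
        = measure_pmf.prob (map_pmf (trunc T) (set_law \<nu> (3 * T + 2) k)) {a. T \<le> a i}"
      by (subst set_law_trunc_le) auto
    also have "\<dots> = measure_pmf.prob (set_law \<nu> (3 * T + 2) k) {a. T \<le> a i}"
      by simp
    finally have "measure_pmf.prob (set_law \<nu> (3 * T + 2) k) {a. T \<le> a i} \<le> X"
      using X[OF k] by simp
    then have "(1 - X) ^ 3 \<le> (1 - measure_pmf.prob (set_law \<nu> (3 * T + 2) k) {a. T \<le> a i}) ^ 3"
      using X1 by (intro power_mono) auto
    then show ?thesis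
      using prob_host_law_ge[OF k, of "set_law \<nu> (3 * T + 2) k" T i] by (simp add: h_def)
  qed
  have "3 * T + 3 = Suc (3 * T + 2)" by simp
  then have "measure_pmf.prob (set_law \<nu> (3 * T + 3) j) {a. 3 * T + 3 \<le> a i}
      = measure_pmf.prob (pair_pmf \<nu> (pair_pmf (h ?k) (h ?l)))
         {(S, w). i \<in> S \<and> (case w of (b, c) \<Rightarrow> 3 * T + 3 \<le> b i \<and> 3 * T + 3 \<le> c i)}"
    by (simp only: set_law.simps measure_map_pmf h_def)
       (auto intro!: arg_cong[where f = "measure_pmf.prob _"] simp: set_msg_def split: if_splits)
  also have "\<dots> = 1 / 2 * (measure_pmf.prob (h ?k) {b. 3 * T + 3 \<le> b i} * measure_pmf.prob (h ?l) {b. 3 * T + 3 \<le> b i})"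
    unfolding prob_pair_pmf_Times half[OF i] ..
  also have "\<dots> \<le> 1 / 2 * ((1 - (1 - X) ^ 3) * (1 - (1 - X) ^ 3))"
    by (intro mult_left_mono mult_mono' hle) auto
  finally show ?thesis by (simp add: power2_eq_square)
qed

text \<open>The trivial bound 1 at round 0 gives 1/2 after one step, and from then on
  \<open>half_cube_le\<close> contracts by 4/5. Hosts triple the round numbers, which explains the
  recursion of \<open>level\<close>.\<close>

lemma prob_set_law_level:
  assumes i: "i \<in> U"
  shows "measure_pmf.prob (set_law \<nu> (level (Suc r)) j) {a. level (Suc r) \<le> a i} \<le> 1 / 2 * (4 / 5) ^ r"
proof (induction r arbitrary: j)
  case 0
  show ?case using prob_set_law_step[OF i, of 0 1 j] by simp
next
  case (Suc r)
  let ?x = "1 / 2 * (4 / 5 :: real) ^ r"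
  have x: "0 \<le> ?x" "?x \<le> 1 / 2" by (auto simp: power_le_one)
  have "measure_pmf.prob (set_law \<nu> (level (Suc (Suc r))) j) {a. level (Suc (Suc r)) \<le> a i}
      \<le> 1 / 2 * (1 - (1 - ?x) ^ 3) ^ 2"
    unfolding level.simps(2)[of "Suc r"] using Suc.IH x by (intro prob_set_law_step[OF i]) auto
  also have "\<dots> \<le> 4 / 5 * ?x" using x by (rule half_cube_le)
  finally show ?case by simp
qed

text \<open>Each of the three edges at a set contributes at most
  \<open>(M + 3 * \<epsilon>) / 4\<close>, and splitting the set costs
  \<open>2 * \<epsilon>\<close>; this gives \<open>9 / 4 + 2 = 17 / 4\<close>. The error vanishes as
  \<open>r\<close> grows, with \<open>U\<close> and \<open>B\<close> fixed.\<close>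

lemma expectation_le: "measure_pmf.expectation \<nu> g \<le> 3 / 4 * M + 17 / 4 * \<epsilon>"
proof -
  define B where "B = Max ((\<lambda>S. \<bar>g S\<bar>) ` Pow U)"
  have B: "\<bar>g S\<bar> \<le> B" if "S \<subseteq> U" for S
    unfolding B_def using that finite_U by (intro Max_ge) auto
  have B0: "0 \<le> B" using B[of "{}"] by simp
  have bound: "measure_pmf.expectation \<nu> g \<le> 3 / 4 * M + 17 / 4 * \<epsilon> + 4 * B * (\<Sum>i\<in>U. 3 / 2 * (4 / 5) ^ r)" for r
  proof -
    define t where "t = level (Suc r)"
    \<comment> \<open>This makes \<open>Suc T = 3 * t + 3\<close>, the threshold in
      \<open>prob_host_law_ge\<close>.\<close>
    define T where "T = 3 * t + 2"
    have "measure_pmf.expectation (pair_pmf (set_law \<nu> (Suc T) j) (host_law j (set_law \<nu> T j))) (\<lambda>(a, b). g (piece a b))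
        \<le> (M + 3 * \<epsilon>) / 4" for j
      unfolding expectation_piece_host_law
      using host_view[of "set_law \<nu> (Suc T) j" j] finite_set_law[OF finite_supp] set_law_support[OF _ supp]
      by (simp del: set_law.simps)
    then have "(\<Sum>j<3. measure_pmf.expectation (pair_pmf (set_law \<nu> (Suc T) j) (host_law j (set_law \<nu> T j))) (\<lambda>(a, b). g (piece a b)))
        \<le> (\<Sum>j<(3::nat). (M + 3 * \<epsilon>) / 4)"
      by (intro sum_mono) blast
    moreover have "measure_pmf.prob (host_law 0 (set_law \<nu> T 0)) {b. Suc T \<le> b i} \<le> 3 / 2 * (4 / 5) ^ r" if i: "i \<in> U" for i
    proof -
      define y where "y = measure_pmf.prob (set_law \<nu> T 0) {a. t \<le> a i}"
      have "y = measure_pmf.prob (map_pmf (trunc t) (set_law \<nu> T 0)) {a. t \<le> a i}"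
        by (simp add: y_def)
      also have "\<dots> = measure_pmf.prob (set_law \<nu> t 0) {a. t \<le> a i}"
        by (subst set_law_trunc_le) (auto simp: T_def)
      finally have y: "y \<le> 1 / 2 * (4 / 5) ^ r"
        using prob_set_law_level[OF i] by (simp add: t_def)
      have y01: "0 \<le> y" "y \<le> 1" by (auto simp: y_def)
      have T: "Suc T = 3 * t + 3" by (simp add: T_def)
      have "measure_pmf.prob (host_law 0 (set_law \<nu> T 0)) {b. Suc T \<le> b i} \<le> 1 - (1 - y) ^ 3"
        unfolding T y_def by (rule prob_host_law_ge) simp
      also have "\<dots> \<le> 3 * y"
        using Bernoulli_inequality[of "- y" 3] y01 by simp
      finally show ?thesis using y by simp
    qed
    then have "4 * B * (\<Sum>i\<in>U. measure_pmf.prob (host_law 0 (set_law \<nu> T 0)) {b. Suc T \<le> b i})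
        \<le> 4 * B * (\<Sum>i\<in>U. 3 / 2 * (4 / 5) ^ r)"
      using B0 by (intro mult_left_mono sum_mono) auto
    ultimately show ?thesis
      using set_view[OF B, of T] by (simp del: set_law.simps)
  qed
  have "(\<lambda>r. 3 / 4 * M + 17 / 4 * \<epsilon> + 4 * B * (\<Sum>i\<in>U. 3 / 2 * (4 / 5) ^ r))
      \<longlonglongrightarrow> 3 / 4 * M + 17 / 4 * \<epsilon> + 4 * B * (\<Sum>i\<in>U. 3 / 2 * 0)"
    by (intro tendsto_intros LIMSEQ_power_zero) auto
  then show ?thesis
    using LIMSEQ_le_const[of _ _ "measure_pmf.expectation \<nu> g"] bound by simp
qed

end

subsection \<open>The upper bound\<close>

text \<open>Mixing \<open>p\<close> with the complements of sets drawn from \<open>q\<close> gives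
  every item probability 1/2. Since \<open>f (U - S)\<close> is at least
  \<open>f U + f {} - f S - \<epsilon>\<close>, the left side is a lower bound for the expectation
  of \<open>f S - f {}\<close> under the mixture.\<close>

lemma balanced_one_sided:
  assumes U: "finite U" and wm: "weakly_modular U \<epsilon> f" and le: "\<And>S. S \<subseteq> U \<Longrightarrow> f S \<le> \<Delta>"
    and bal: "balanced U p q"
  shows "1 / 2 * (measure_pmf.expectation p f - measure_pmf.expectation q f + f U + f {} - \<epsilon>) - f {}
    \<le> 3 / 4 * (\<Delta> - f {}) + 17 / 4 * \<epsilon>"
proof -
  have p: "set_pmf p \<subseteq> Pow U" and q: "set_pmf q \<subseteq> Pow U"
    and marg: "\<And>i. i \<in> U \<Longrightarrow> measure_pmf.prob p {S. i \<in> S} = measure_pmf.prob q {S. i \<in> S}"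
    using bal by (auto simp: balanced_def)
  have fin: "finite (set_pmf p)" "finite (set_pmf q)"
    using p q U by (meson finite_Pow_iff finite_subset)+
  have add: "\<bar>f S + f T - f (S \<union> T) - f {}\<bar> \<le> \<epsilon>" if "S \<subseteq> U" "T \<subseteq> U" "S \<inter> T = {}" for S T
    using wm that unfolding weakly_modular_def by metis
  define g where "g = (\<lambda>S. f S - f {})"
  define \<nu> where "\<nu> = bind_pmf (bernoulli_pmf (1 / 2)) (\<lambda>b. if b then p else map_pmf (\<lambda>S. U - S) q)"
  have E: "measure_pmf.expectation \<nu> h
      = 1 / 2 * measure_pmf.expectation p h + 1 / 2 * measure_pmf.expectation q (\<lambda>S. h (U - S))" for h :: "'a set \<Rightarrow> real"
    unfolding \<nu>_def using fin by (subst pmf_expectation_bind[of UNIV]) (auto simp: UNIV_bool)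
  interpret half_density U \<nu> g \<epsilon> "\<Delta> - f {}"
  proof
    show "set_pmf \<nu> \<subseteq> Pow U" using p q by (auto simp: \<nu>_def split: if_splits)
  next
    fix i assume i: "i \<in> U"
    have "measure_pmf.prob \<nu> {S. i \<in> S} = measure_pmf.expectation \<nu> (indicator {S. i \<in> S})" by simp
    also have "\<dots> = 1 / 2 * measure_pmf.prob p {S. i \<in> S}
        + 1 / 2 * measure_pmf.expectation q (\<lambda>S. indicator {S. i \<in> S} (U - S))"
      unfolding E by simp
    also have "(\<lambda>S. indicator {S. i \<in> S} (U - S)) = (indicator (- {S. i \<in> S}) :: 'a set \<Rightarrow> real)"
      using i by (auto simp: indicator_def)
    also have "measure_pmf.expectation q (indicator (- {S. i \<in> S})) = 1 - measure_pmf.prob q {S. i \<in> S}"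
      using measure_pmf.prob_compl[of "{S. i \<in> S}" q] by (simp add: Compl_eq_Diff_UNIV)
    finally show "measure_pmf.prob \<nu> {S. i \<in> S} = 1 / 2" using marg[OF i] by (simp add: diff_divide_distrib)
  next
    fix S T assume "S \<subseteq> U" "T \<subseteq> U" "S \<inter> T = {}"
    from add[OF this] show "\<bar>g S + g T - g (S \<union> T)\<bar> \<le> \<epsilon>" by (simp add: g_def abs_le_iff)
  next
    fix S assume "S \<subseteq> U"
    from le[OF this] show "g S \<le> \<Delta> - f {}" by (simp add: g_def)
  qed (simp_all add: g_def U)
  have "measure_pmf.expectation q (\<lambda>S. f U - \<epsilon> - f S) \<le> measure_pmf.expectation q (\<lambda>S. g (U - S))"
  proof (rule expectation_pmf_mono[OF fin(2)])
    fix S assume "S \<in> set_pmf q"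
    then have S: "S \<subseteq> U" using q by auto
    then have "S \<union> (U - S) = U" by auto
    then show "f U - \<epsilon> - f S \<le> g (U - S)"
      using add[OF S, of "U - S"] by (simp add: g_def abs_le_iff)
  qed
  moreover have "measure_pmf.expectation q (\<lambda>S. f U - \<epsilon> - f S) = f U - \<epsilon> - measure_pmf.expectation q f"
    using fin by (subst Bochner_Integration.integral_diff) (auto intro: integrable_measure_pmf_finite)
  moreover have "measure_pmf.expectation p g = measure_pmf.expectation p f - f {}"
    unfolding g_def using fin by (subst Bochner_Integration.integral_diff) (auto intro: integrable_measure_pmf_finite)
  ultimately show ?thesis using expectation_le E[of g] by (simp add: field_simps)
qed

lemma weakly_modular_uminus:
  assumes "weakly_modular U \<epsilon> f"
  shows "weakly_modular U \<epsilon> (\<lambda>S. - f S)"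
proof -
  have "- f S + - f T - - f (S \<union> T) - - f (S \<inter> T) = - (f S + f T - f (S \<union> T) - f (S \<inter> T))" for S T
    by simp
  then show ?thesis using assms unfolding weakly_modular_def by (simp only: abs_minus_cancel)
qed

lemma balanced_sym: "balanced U p q \<Longrightarrow> balanced U q p"
  by (auto simp: balanced_def)

text \<open>The one-sided estimate is applied to \<open>f\<close> with \<open>(p, q)\<close> and to
  \<open>- f\<close> with \<open>(q, p)\<close>. In the sum the terms in \<open>f U\<close> and
  \<open>f {}\<close> cancel, and the error is \<open>2 * (17 / 4) + 1 = 2 * (19 / 4)\<close> times
  \<open>\<epsilon>\<close>.\<close>

lemma bounded_contraction:
  assumes U: "finite U" and wm: "weakly_modular U \<epsilon> f" and le: "\<And>S. S \<subseteq> U \<Longrightarrow> \<bar>f S\<bar> \<le> \<Delta>"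
  shows "delta_linear U (3 / 4 * \<Delta> + 19 / 4 * \<epsilon>) f"
proof (rule delta_linear_dual[OF U])
  fix p q assume bal: "balanced U p q"
  have "1 / 2 * (measure_pmf.expectation p f - measure_pmf.expectation q f + f U + f {} - \<epsilon>) - f {}
      \<le> 3 / 4 * (\<Delta> - f {}) + 17 / 4 * \<epsilon>"
    using le by (intro balanced_one_sided[OF U wm _ bal]) (auto simp: abs_le_iff)
  moreover have "1 / 2 * (measure_pmf.expectation q (\<lambda>S. - f S) - measure_pmf.expectation p (\<lambda>S. - f S) + - f U + - f {} - \<epsilon>) - - f {}
      \<le> 3 / 4 * (\<Delta> - - f {}) + 17 / 4 * \<epsilon>"
    using le by (intro balanced_one_sided[OF U weakly_modular_uminus[OF wm] _ balanced_sym[OF bal]]) (auto simp: abs_le_iff)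
  ultimately show "measure_pmf.expectation p f - measure_pmf.expectation q f \<le> 2 * (3 / 4 * \<Delta> + 19 / 4 * \<epsilon>)"
    by (simp add: field_simps)
qed

lemma linear_set_fun_modular:
  assumes "finite U" "linear_set_fun U l" "S \<subseteq> U" "T \<subseteq> U" "S \<inter> T = {}"
  shows "l S + l T = l (S \<union> T) + l (S \<inter> T)"
proof -
  obtain c0 c where l: "\<And>S. S \<subseteq> U \<Longrightarrow> l S = c0 + (\<Sum>i\<in>S. c i)"
    using assms(2) by (auto simp: linear_set_fun_def)
  have "finite S" "finite T" using assms by (auto intro: finite_subset)
  then show ?thesis using assms by (simp add: l sum.union_disjoint)
qed

lemma delta_linear_add_linear:
  assumes "delta_linear U \<Delta> (\<lambda>S. f S - l S)" "linear_set_fun U l"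
  shows "delta_linear U \<Delta> f"
proof -
  obtain k where k: "linear_set_fun U k" "\<And>S. S \<subseteq> U \<Longrightarrow> \<bar>f S - l S - k S\<bar> \<le> \<Delta>"
    using assms(1) unfolding delta_linear_def by auto
  obtain c0 c d0 d where "\<And>S. S \<subseteq> U \<Longrightarrow> l S = c0 + (\<Sum>i\<in>S. c i)" "\<And>S. S \<subseteq> U \<Longrightarrow> k S = d0 + (\<Sum>i\<in>S. d i)"
    using assms(2) k(1) unfolding linear_set_fun_def by metis
  then have "linear_set_fun U (\<lambda>S. l S + k S)"
    unfolding linear_set_fun_def
    by (intro exI[of _ "c0 + d0"] exI[of _ "\<lambda>i. c i + d i"]) (auto simp: sum.distrib)
  then show ?thesis
    unfolding delta_linear_def using k(2) by (intro exI[of _ "\<lambda>S. l S + k S"]) (auto simp: diff_diff_eq)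
qed

lemma delta_linear_contraction:
  assumes U: "finite U" and wm: "weakly_modular U \<epsilon> f" and lin: "delta_linear U \<Delta> f"
  shows "delta_linear U (3 / 4 * \<Delta> + 19 / 4 * \<epsilon>) f"
proof -
  obtain l where l: "linear_set_fun U l" and d: "\<And>S. S \<subseteq> U \<Longrightarrow> \<bar>f S - l S\<bar> \<le> \<Delta>"
    using lin by (auto simp: delta_linear_def)
  have "weakly_modular U \<epsilon> (\<lambda>S. f S - l S)"
    unfolding weakly_modular_def
  proof (intro allI impI)
    fix S T assume ST: "S \<subseteq> U" "T \<subseteq> U" "S \<inter> T = {}"
    have eq: "f S - l S + (f T - l T) - (f (S \<union> T) - l (S \<union> T)) - (f (S \<inter> T) - l (S \<inter> T))
        = f S + f T - f (S \<union> T) - f (S \<inter> T)"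
      using linear_set_fun_modular[OF U l ST] by simp
    then show "\<bar>f S - l S + (f T - l T) - (f (S \<union> T) - l (S \<union> T)) - (f (S \<inter> T) - l (S \<inter> T))\<bar> \<le> \<epsilon>"
      unfolding eq using wm ST unfolding weakly_modular_def by blast
  qed
  from bounded_contraction[OF U this d] show ?thesis
    by (rule delta_linear_add_linear[OF _ l])
qed

text \<open>The infimum \<open>D0\<close> of the admissible distances satisfies
  \<open>D0 \<le> 3 / 4 * D0 + 19 / 4 * \<epsilon>\<close>, hence is at most
  \<open>19 * \<epsilon>\<close>; it is attained by closedness.\<close>

lemma weakly_modular_delta_linear:
  assumes U: "finite U" and wm: "weakly_modular U \<epsilon> f"
  shows "delta_linear U (19 * \<epsilon>) f"
proof -
  define D where "D = {\<Delta>. delta_linear U \<Delta> f}"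
  define D0 where "D0 = Inf D"
  have "delta_linear U (Max ((\<lambda>S. \<bar>f S\<bar>) ` Pow U)) f"
    unfolding delta_linear_def linear_set_fun_def
    using U by (intro exI[of _ "\<lambda>_. 0"] conjI exI[of _ 0] exI[of _ "\<lambda>_. 0"]) (auto intro!: Max_ge)
  then have ne: "D \<noteq> {}" by (auto simp: D_def)
  have "0 \<le> \<Delta>" if "\<Delta> \<in> D" for \<Delta>
    using that unfolding D_def delta_linear_def by (force intro: order_trans[OF abs_ge_zero])
  then have bdd: "bdd_below D" by (rule bdd_belowI)
  have "4 / 3 * (D0 - 19 / 4 * \<epsilon>) \<le> \<Delta>" if "\<Delta> \<in> D" for \<Delta>
  proof -
    have "3 / 4 * \<Delta> + 19 / 4 * \<epsilon> \<in> D"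
      using delta_linear_contraction[OF U wm] that by (simp add: D_def)
    then have "D0 \<le> 3 / 4 * \<Delta> + 19 / 4 * \<epsilon>"
      unfolding D0_def using bdd by (rule cInf_lower)
    then show ?thesis by simp
  qed
  then have "4 / 3 * (D0 - 19 / 4 * \<epsilon>) \<le> D0"
    unfolding D0_def by (rule cInf_greatest[OF ne])
  then have le: "D0 \<le> 19 * \<epsilon>" by simp
  have "delta_linear U \<Delta> f" if gt: "\<Delta> > D0" for \<Delta>
  proof -
    obtain \<Delta>' where "\<Delta>' \<in> D" "\<Delta>' < \<Delta>" using cInf_lessD[OF ne] gt unfolding D0_def by blast
    then show ?thesis using delta_linear_mono[of U \<Delta>' f \<Delta>] by (simp add: D_def)
  qed
  then have "delta_linear U D0 f" by (rule delta_linear_closed[OF U])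
  then show ?thesis using le by (rule delta_linear_mono)
qed

subsection \<open>Stars in the 3-subsets of a 6-set\<close>

definition star_items :: "nat set set" where
  "star_items = {A. A \<subseteq> {..<6} \<and> card A = 3}"

definition star :: "nat \<Rightarrow> nat set set" where
  "star a = {A \<in> star_items. a \<in> A}"

definition costar :: "nat \<Rightarrow> nat set set" where
  "costar a = {A \<in> star_items. a \<notin> A}"

definition in_star :: "nat set set \<Rightarrow> bool" where
  "in_star S \<longleftrightarrow> (\<exists>a<6. S \<subseteq> star a)"

definition in_costar :: "nat set set \<Rightarrow> bool" where
  "in_costar S \<longleftrightarrow> (\<exists>a<6. S \<subseteq> costar a)"

definition sgn_star :: "nat set set \<Rightarrow> int" where
  "sgn_star S = of_bool (in_star S) - of_bool (in_costar S)"

text \<open>Above the middle size the values are fixed by oddness under complements. At size 10 the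
  sign is nonzero exactly on the stars and costars, so only these reach 3 and -3.\<close>

definition star_fun :: "nat set set \<Rightarrow> int" where
  "star_fun S = (if card S < 10 then sgn_star S else if card S = 10 then 3 * sgn_star S
     else - sgn_star (star_items - S))"

lemma finite_star_items: "finite star_items"
  by (simp add: star_items_def)

lemma card_star_items: "card star_items = 20"
proof -
  have "card star_items = 6 choose 3"
    unfolding star_items_def using n_subsets[of "{..<6::nat}" 3] by simp
  also have "\<dots> = 20" by (simp add: eval_nat_numeral)
  finally show ?thesis .
qed

lemma card_star: "a < 6 \<Longrightarrow> card (star a) = 10" and card_costar: "a < 6 \<Longrightarrow> card (costar a) = 10"
proof -
  assume a: "a < 6"
  have "costar a = {A. A \<subseteq> {..<6} - {a} \<and> card A = 3}"
    by (auto simp: costar_def star_items_def)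
  then have "card (costar a) = card ({..<6} - {a}) choose 3"
    using n_subsets[of "{..<6} - {a}" 3] by simp
  also have "card ({..<6} - {a}) = 5" using a by simp
  also have "(5::nat) choose 3 = 10" by (simp add: eval_nat_numeral)
  finally show c: "card (costar a) = 10" .
  have "star a = star_items - costar a" by (auto simp: star_def costar_def)
  moreover have "costar a \<subseteq> star_items" by (auto simp: costar_def)
  ultimately have "card (star a) = card star_items - card (costar a)"
    using finite_star_items by (simp add: card_Diff_subset finite_subset)
  then show "card (star a) = 10" by (simp add: c card_star_items)
qed

text \<open>Consequently three costars never cover all items.\<close>

lemma ex_item_containing:
  assumes "a < 6" "b < 6" "c < 6"
  shows "\<exists>A\<in>star_items. a \<in> A \<and> b \<in> A \<and> c \<in> A"
proof -
  have "card {a, b, c} \<le> 3" by (auto simp: card_insert_if)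
  moreover have "{a, b, c} \<subseteq> {..<6}" using assms by auto
  ultimately obtain A where "{a, b, c} \<subseteq> A" "A \<subseteq> {..<6}" "card A = 3"
    using exists_subset_between[of "{a, b, c}" 3 "{..<6}"] by auto
  then show ?thesis by (auto simp: star_items_def)
qed

text \<open>The complement of an item through the three points avoids them. Consequently three stars
  never cover all items.\<close>

lemma ex_item_avoiding:
  assumes "a < 6" "b < 6" "c < 6"
  shows "\<exists>A\<in>star_items. a \<notin> A \<and> b \<notin> A \<and> c \<notin> A"
proof -
  obtain A where A: "A \<in> star_items" "a \<in> A" "b \<in> A" "c \<in> A"
    using ex_item_containing[OF assms] by blast
  have "card ({..<6} - A) = 3"
    using A by (subst card_Diff_subset) (auto simp: star_items_def intro: finite_subset)
  then show ?thesis using A by (intro bexI[of _ "{..<6} - A"]) (auto simp: star_items_def)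
qed

lemma sgn_star_range: "sgn_star S \<le> 1" "- 1 \<le> sgn_star S"
  by (simp_all add: sgn_star_def)

lemma star_subset: "star a \<subseteq> star_items" and costar_subset: "costar a \<subseteq> star_items"
  by (auto simp: star_def costar_def)

lemma Diff_star: "star_items - star a = costar a" and Diff_costar: "star_items - costar a = star a"
  by (auto simp: star_def costar_def)

lemma finite_star: "finite (star a)" and finite_costar: "finite (costar a)"
  using finite_star_items by (auto intro: finite_subset[OF star_subset] finite_subset[OF costar_subset])

lemma card_Diff_star_items: "S \<subseteq> star_items \<Longrightarrow> card (star_items - S) = 20 - card S"
  using finite_star_items by (simp add: card_Diff_subset finite_subset card_star_items)

lemma in_star_card10: "card S = 10 \<Longrightarrow> in_star S \<longleftrightarrow> (\<exists>a<6. S = star a)"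
  unfolding in_star_def by (metis card_star card_subset_eq finite_star order_refl)

lemma in_costar_card10: "card S = 10 \<Longrightarrow> in_costar S \<longleftrightarrow> (\<exists>a<6. S = costar a)"
  unfolding in_costar_def by (metis card_costar card_subset_eq finite_costar order_refl)

text \<open>Away from size 10 this is built into the definition; at size 10 complementation
  exchanges stars and costars.\<close>

lemma star_fun_Diff:
  assumes S: "S \<subseteq> star_items"
  shows "star_fun (star_items - S) = - star_fun S"
proof -
  have dd: "star_items - (star_items - S) = S" using S by auto
  consider "card S < 10" | "card S = 10" | "card S > 10" by linarith
  then show ?thesis
  proof cases
    case 1
    then have "card (star_items - S) > 10" using card_Diff_star_items[OF S] by simp
    then show ?thesis using 1 by (simp add: star_fun_def dd)
  next
    case 2
    then have c: "card (star_items - S) = 10" using card_Diff_star_items[OF S] by simp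
    have "in_star (star_items - S) \<longleftrightarrow> in_costar S" "in_costar (star_items - S) \<longleftrightarrow> in_star S"
      unfolding in_star_card10[OF c] in_costar_card10[OF c] in_star_card10[OF 2] in_costar_card10[OF 2]
      using dd Diff_star Diff_costar by metis+
    then show ?thesis using 2 c by (simp add: star_fun_def sgn_star_def)
  next
    case 3
    then have "card (star_items - S) < 10" using card_Diff_star_items[OF S] by simp
    then show ?thesis using 3 by (simp add: star_fun_def)
  qed
qed

lemma star_fun_empty: "star_fun {} = 0"
  by (simp add: star_fun_def sgn_star_def in_star_def in_costar_def)

section \<open>Partitions of the items into three parts\<close>

lemma sgn_star_pos: "sgn_star S > 0 \<longleftrightarrow> in_star S \<and> \<not> in_costar S"
  by (auto simp: sgn_star_def)

lemma sgn_star_neg: "sgn_star S < 0 \<longleftrightarrow> in_costar S \<and> \<not> in_star S"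
  by (auto simp: sgn_star_def)

lemma in_costar_mono: "in_costar S \<Longrightarrow> T \<subseteq> S \<Longrightarrow> in_costar T"
  unfolding in_costar_def by blast

text \<open>If \<open>R\<close> is larger than 10, a sum of 3 would need \<open>S \<union> T\<close>
  inside a costar but \<open>S\<close> inside none. If \<open>R\<close> has size 10, the critical
  case is a star, whose value 3 must be offset by a negative part.\<close>

lemma star_fun_sum_le_aux:
  assumes part: "S \<inter> T = {}" "S \<union> T = star_items - R" "R \<subseteq> star_items" and R: "10 \<le> card R"
  shows "star_fun S + star_fun T + star_fun R \<le> 2"
proof -
  have fin: "finite S" "finite T"
    using part finite_star_items by (metis finite_Diff finite_Un)+
  have cST: "card S + card T = 20 - card R"
    using part fin card_Diff_star_items card_Un_disjoint by metis
  consider "card R > 10" | "card R = 10" "card S = 10" | "card R = 10" "card T = 10"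
    | "card R = 10" "card S < 10" "card T < 10"
    using cST R by linarith
  then show ?thesis
  proof cases
    case 1
    then have "card S < 10" "card T < 10" using cST by linarith+
    then have f: "star_fun S = sgn_star S" "star_fun T = sgn_star T" "star_fun R = - sgn_star (S \<union> T)"
      using 1 part by (simp_all add: star_fun_def)
    have "\<not> (sgn_star S > 0 \<and> sgn_star (S \<union> T) < 0)"
      using in_costar_mono[of "S \<union> T" S] by (auto simp: sgn_star_pos sgn_star_neg)
    then show ?thesis using sgn_star_range[of S] sgn_star_range[of T] sgn_star_range[of "S \<union> T"]
      unfolding f by linarith
  next
    case 2
    then have "T = {}" using cST fin by simp
    moreover from this have "S = star_items - R" using part by simp
    ultimately show ?thesis using star_fun_Diff[OF part(3)] star_fun_empty by simp
  next
    case 3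
    then have "S = {}" using cST fin by simp
    moreover from this have "T = star_items - R" using part by simp
    ultimately show ?thesis using star_fun_Diff[OF part(3)] star_fun_empty by simp
  next
    case 4
    then have f: "star_fun S = sgn_star S" "star_fun T = sgn_star T" "star_fun R = 3 * sgn_star R"
      by (simp_all add: star_fun_def)
    show ?thesis
    proof (cases "sgn_star R > 0")
      case True
      then obtain a where a: "a < 6" "R = star a"
        using in_star_card10[OF 4(1)] by (auto simp: sgn_star_pos)
      then have ST: "S \<union> T = costar a" using part Diff_star by simp
      then have co: "in_costar S" "in_costar T" using a by (auto simp: in_costar_def)
      \<comment> \<open>Otherwise an item avoiding \<open>a\<close>, \<open>b\<close> and
        \<open>c\<close> would lie in \<open>costar a\<close> but in neither part. So one part has
        sign -1 and the other at most 0.\<close>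
      have "\<not> (in_star S \<and> in_star T)"
      proof
        assume "in_star S \<and> in_star T"
        then obtain b c where bc: "b < 6" "c < 6" "S \<subseteq> star b" "T \<subseteq> star c"
          by (auto simp: in_star_def)
        obtain A where "A \<in> star_items" "a \<notin> A" "b \<notin> A" "c \<notin> A"
          using ex_item_avoiding a bc by blast
        then show False using ST bc by (auto simp: star_def costar_def)
      qed
      then have "sgn_star S + sgn_star T \<le> - 1" using co by (auto simp: sgn_star_def)
      then show ?thesis using sgn_star_range[of R] unfolding f by linarith
    next
      case False
      then show ?thesis using sgn_star_range[of S] sgn_star_range[of T] unfolding f by linarith
    qed
  qed
qed

text \<open>When all parts are small, a sum of 3 would place each part inside a star, and three
  stars would cover all items.\<close>

lemma star_fun_sum_le:
  assumes "S \<inter> T = {}" "S \<inter> R = {}" "T \<inter> R = {}" "S \<union> T \<union> R = star_items"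
  shows "star_fun S + star_fun T + star_fun R \<le> 2"
proof -
  consider "10 \<le> card S" | "10 \<le> card T" | "10 \<le> card R" | "card S < 10" "card T < 10" "card R < 10"
    by linarith
  then show ?thesis
  proof cases
    case 1
    have "T \<union> R = star_items - S" "S \<subseteq> star_items" using assms by auto
    from star_fun_sum_le_aux[OF assms(3) this 1] show ?thesis by simp
  next
    case 2
    have "S \<union> R = star_items - T" "T \<subseteq> star_items" using assms by auto
    from star_fun_sum_le_aux[OF assms(2) this 2] show ?thesis by simp
  next
    case 3
    have "S \<union> T = star_items - R" "R \<subseteq> star_items" using assms by auto
    from star_fun_sum_le_aux[OF assms(1) this 3] show ?thesis by simp
  next
    case 4
    then have f: "star_fun S = sgn_star S" "star_fun T = sgn_star T" "star_fun R = sgn_star R"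
      by (simp_all add: star_fun_def)
    have "\<not> (in_star S \<and> in_star T \<and> in_star R)"
    proof
      assume "in_star S \<and> in_star T \<and> in_star R"
      then obtain a b c where abc: "a < 6" "b < 6" "c < 6" "S \<subseteq> star a" "T \<subseteq> star b" "R \<subseteq> star c"
        unfolding in_star_def by blast
      obtain A where "A \<in> star_items" "a \<notin> A" "b \<notin> A" "c \<notin> A"
        using ex_item_avoiding abc by blast
      then show False using assms(4) abc by (auto simp: star_def)
    qed
    then have "\<not> (sgn_star S > 0 \<and> sgn_star T > 0 \<and> sgn_star R > 0)" by (auto simp: sgn_star_pos)
    then show ?thesis using sgn_star_range[of S] sgn_star_range[of T] sgn_star_range[of R]
      unfolding f by linarith
  qed
qed

section \<open>The symmetry replacing each item by its complement in the 6-set\<close>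

definition flip_items :: "nat set set \<Rightarrow> nat set set" where
  "flip_items S = (\<lambda>A. {..<6} - A) ` S"

lemma flip_item_inj: "inj_on (\<lambda>A. {..<6} - A) star_items"
  by (rule inj_on_inverseI[where g = "\<lambda>A. {..<6} - A"]) (auto simp: star_items_def)

lemma flip_item_mem: "A \<in> star_items \<Longrightarrow> {..<6} - A \<in> star_items"
  by (auto simp: star_items_def card_Diff_subset finite_subset)

lemma flip_items_all: "flip_items star_items = star_items"
proof
  show "star_items \<subseteq> flip_items star_items"
  proof
    fix A assume A: "A \<in> star_items"
    then have "A = {..<6} - ({..<6} - A)" by (auto simp: star_items_def)
    then show "A \<in> flip_items star_items"
      unfolding flip_items_def using flip_item_mem[OF A] by blast
  qed
qed (auto simp: flip_items_def flip_item_mem)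

lemma flip_items_Un: "flip_items (S \<union> T) = flip_items S \<union> flip_items T"
  by (simp add: flip_items_def image_Un)

lemma flip_items_Int:
  "S \<subseteq> star_items \<Longrightarrow> T \<subseteq> star_items \<Longrightarrow> flip_items (S \<inter> T) = flip_items S \<inter> flip_items T"
  unfolding flip_items_def by (rule inj_on_image_Int[OF flip_item_inj])

lemma flip_items_Diff: "S \<subseteq> star_items \<Longrightarrow> flip_items (star_items - S) = star_items - flip_items S"
  using inj_on_image_set_diff[OF flip_item_inj, of star_items S] flip_items_all
  by (simp add: flip_items_def)

lemma card_flip_items: "S \<subseteq> star_items \<Longrightarrow> card (flip_items S) = card S"
  unfolding flip_items_def by (intro card_image inj_on_subset[OF flip_item_inj])

text \<open>A point lies in an item exactly when it misses the complementary item, so the flip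
  exchanges stars and costars.\<close>

lemma sgn_star_flip:
  assumes "S \<subseteq> star_items"
  shows "sgn_star (flip_items S) = - sgn_star S"
proof -
  have "flip_items S \<subseteq> star a \<longleftrightarrow> S \<subseteq> costar a" "flip_items S \<subseteq> costar a \<longleftrightarrow> S \<subseteq> star a" if "a < 6" for a
    using assms that flip_item_mem by (auto simp: flip_items_def star_def costar_def)
  then have "in_star (flip_items S) \<longleftrightarrow> in_costar S" "in_costar (flip_items S) \<longleftrightarrow> in_star S"
    unfolding in_star_def in_costar_def by metis+
  then show ?thesis by (simp add: sgn_star_def)
qed

lemma star_fun_flip: "S \<subseteq> star_items \<Longrightarrow> star_fun (flip_items S) = - star_fun S"
  by (simp add: star_fun_def card_flip_items sgn_star_flip flip_items_Diff[symmetric])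

text \<open>By oddness the expression is the sum of the values on the parts \<open>S\<close>,
  \<open>T\<close> and \<open>R\<close> of a partition. The bound from below is the bound from above
  for the flipped partition.\<close>

lemma star_fun_weakly_modular:
  assumes ST: "S \<subseteq> star_items" "T \<subseteq> star_items" "S \<inter> T = {}"
  shows "\<bar>star_fun S + star_fun T - star_fun (S \<union> T)\<bar> \<le> 2"
proof -
  define R where "R = star_items - (S \<union> T)"
  have part: "S \<inter> T = {}" "S \<inter> R = {}" "T \<inter> R = {}" "S \<union> T \<union> R = star_items" and R: "R \<subseteq> star_items"
    using ST by (auto simp: R_def)
  have "star_fun R = - star_fun (S \<union> T)" unfolding R_def using ST by (intro star_fun_Diff) auto
  moreover have "star_fun S + star_fun T + star_fun R \<le> 2" by (rule star_fun_sum_le[OF part])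
  moreover have "star_fun (flip_items S) + star_fun (flip_items T) + star_fun (flip_items R) \<le> 2"
    using part ST R by (intro star_fun_sum_le) (simp_all flip: flip_items_Int flip_items_Un add: flip_items_all, simp_all add: flip_items_def)
  then have "- star_fun S - star_fun T - star_fun R \<le> 2" using ST R by (simp add: star_fun_flip)
  ultimately show ?thesis by (simp add: abs_le_iff)
qed

lemma star_fun_star: "a < 6 \<Longrightarrow> star_fun (star a) = 3"
  and star_fun_costar: "a < 6 \<Longrightarrow> star_fun (costar a) = - 3"
proof -
  assume a: "a < 6"
  have "in_star (star a)" using a by (auto simp: in_star_def)
  moreover have "\<not> in_costar (star a)"
    unfolding in_costar_def using ex_item_containing[OF a a] by (fastforce simp: star_def costar_def)
  ultimately show s: "star_fun (star a) = 3"
    by (simp add: star_fun_def card_star[OF a] sgn_star_def)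
  show "star_fun (costar a) = - 3"
    using star_fun_Diff[OF star_subset, of a] s by (simp add: Diff_star)
qed

section \<open>Tightness of the distance 3\<close>

lemma abs_star_fun_le: "\<bar>star_fun S\<bar> \<le> 3"
  using sgn_star_range[of S] sgn_star_range[of "star_items - S"] by (auto simp: star_fun_def)

text \<open>Each item lies in three of the stars and three of the costars, so the uniform
  distributions on stars and on costars are indistinguishable to linear functions.\<close>

lemma sum_star_weights:
  assumes "A \<in> star_items"
  shows "(\<Sum>a<6. if a \<in> A then x else - x) = (0 :: real)"
proof -
  have A: "A \<subseteq> {..<6}" "card A = 3" "finite A" using assms by (auto simp: star_items_def finite_subset)
  have "(\<Sum>a<6. if a \<in> A then x else - x) = (\<Sum>a\<in>{..<6} - A. - x) + (\<Sum>a\<in>A. x)"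
    using A(1) by (subst sum.subset_diff[of A]) (auto intro!: arg_cong2[where f = "(+)"] sum.cong)
  also have "card ({..<6} - A) = 3" using A by (simp add: card_Diff_subset)
  then have "(\<Sum>a\<in>{..<6} - A. - x) + (\<Sum>a\<in>A. x) = 0" using A by simp
  finally show ?thesis .
qed

lemma ex_tightly_linear:
  "\<exists>f. (\<forall>S. S \<subseteq> {1..20::nat} \<longrightarrow> f S \<in> \<int>) \<and> weakly_modular {1..20} 2 f \<and> tightly_linear {1..20} 3 f"
proof -
  obtain h where h: "bij_betw h {1..20::nat} star_items"
    using ex_bij_betw_nat_finite_1[OF finite_star_items] by (auto simp: card_star_items)
  then have inj: "inj_on h {1..20}" and img: "h ` {1..20} = star_items" by (auto simp: bij_betw_def)
  define f where "f = (\<lambda>S. real_of_int (star_fun (h ` S)))"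
  have wm: "weakly_modular {1..20} 2 f"
    unfolding weakly_modular_def
  proof (intro allI impI)
    fix S T :: "nat set" assume ST: "S \<subseteq> {1..20}" "T \<subseteq> {1..20}" "S \<inter> T = {}"
    have "h ` S \<subseteq> star_items" "h ` T \<subseteq> star_items" using ST img by blast+
    moreover have "h ` S \<inter> h ` T = {}" using ST inj_on_image_Int[OF inj ST(1,2)] by simp
    ultimately have "\<bar>star_fun (h ` S) + star_fun (h ` T) - star_fun (h ` S \<union> h ` T)\<bar> \<le> 2"
      by (rule star_fun_weakly_modular)
    then have "\<bar>star_fun (h ` S) + star_fun (h ` T) - star_fun (h ` (S \<union> T)) - star_fun (h ` (S \<inter> T))\<bar> \<le> 2"
      using ST by (simp add: image_Un star_fun_empty)
    then show "\<bar>f S + f T - f (S \<union> T) - f (S \<inter> T)\<bar> \<le> 2"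
      unfolding f_def by (simp only: of_int_abs[symmetric] of_int_add[symmetric] of_int_diff[symmetric] of_int_le_numeral_iff)
  qed
  have lin: "delta_linear {1..20} 3 f"
  proof -
    have "\<bar>f S\<bar> \<le> 3" for S
      unfolding f_def using abs_star_fun_le[of "h ` S"] by (simp only: of_int_abs[symmetric] of_int_le_numeral_iff)
    then show ?thesis unfolding delta_linear_def linear_set_fun_def
      by (intro exI[of _ "\<lambda>_. 0"] conjI exI[of _ 0] exI[of _ "\<lambda>_. 0"]) auto
  qed
  have "3 \<le> \<Delta>" if dl: "delta_linear {1..20} \<Delta> f" for \<Delta>
  proof -
    obtain l where lin: "linear_set_fun {1..20} l"
      and d: "\<And>S. S \<subseteq> {1..20} \<Longrightarrow> \<bar>f S - l S\<bar> \<le> \<Delta>"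
      using dl unfolding delta_linear_def by blast
    obtain c0 c where l: "\<And>S. S \<subseteq> {1..20} \<Longrightarrow> l S = c0 + (\<Sum>i\<in>S. c i)"
      using lin unfolding linear_set_fun_def by blast
    \<comment> \<open>\<open>P a\<close> and \<open>N a\<close> are the preimages under
      \<open>h\<close> of the star and the costar of \<open>a\<close>.\<close>
    define P where "P = (\<lambda>a. {i \<in> {1..20}. a \<in> h i})"
    define N where "N = (\<lambda>a. {i \<in> {1..20}. a \<notin> h i})"
    have "h ` P a = star a" "h ` N a = costar a" for a
      unfolding P_def N_def star_def costar_def img[symmetric] by auto
    then have fPN: "f (P a) = 3" "f (N a) = - 3" if "a < 6" for a
      using that by (simp_all add: f_def star_fun_star star_fun_costar)
    have sub: "P a \<subseteq> {1..20}" "N a \<subseteq> {1..20}" for a by (auto simp: P_def N_def)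
    have lPN: "l (P a) - l (N a) = (\<Sum>i\<in>{1..20}. if a \<in> h i then c i else - c i)" for a
    proof -
      have "(\<Sum>i\<in>P a. c i) = (\<Sum>i\<in>{1..20}. if a \<in> h i then c i else 0)"
        "(\<Sum>i\<in>N a. c i) = (\<Sum>i\<in>{1..20}. if a \<notin> h i then c i else 0)"
        unfolding P_def N_def by (simp_all only: sum.inter_filter[OF finite_atLeastAtMost])
      then have "l (P a) - l (N a)
          = (\<Sum>i\<in>{1..20}. (if a \<in> h i then c i else 0) - (if a \<notin> h i then c i else 0))"
        using l sub by (simp add: sum_subtractf)
      also have "\<dots> = (\<Sum>i\<in>{1..20}. if a \<in> h i then c i else - c i)"
        by (intro sum.cong) auto
      finally show ?thesis .
    qed
    have "(\<Sum>a<6. l (P a) - l (N a)) = (\<Sum>i\<in>{1..20}. \<Sum>a<6. if a \<in> h i then c i else - c i)"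
      unfolding lPN by (rule sum.swap)
    also have "\<dots> = 0"
    proof (rule sum.neutral, rule ballI)
      fix i assume "i \<in> {1..20::nat}"
      then have "h i \<in> star_items" using img by blast
      then show "(\<Sum>a<6. if a \<in> h i then c i else - c i) = 0" by (rule sum_star_weights)
    qed
    finally have "(\<Sum>a<6. l (P a) - l (N a)) = 0" .
    \<comment> \<open>\<open>f\<close> drops by 6 from \<open>P a\<close> to \<open>N a\<close>, and
      \<open>l\<close> follows \<open>f\<close> up to \<open>\<Delta>\<close> at both ends. As the
      six differences of \<open>l\<close> sum to 0, \<open>6 - 2 * \<Delta>\<close> cannot be
      positive.\<close>
    moreover have "(\<Sum>a<(6::nat). 6 - 2 * \<Delta>) \<le> (\<Sum>a<6. l (P a) - l (N a))"
    proof (rule sum_mono)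
      fix a :: nat assume "a \<in> {..<6}"
      then show "6 - 2 * \<Delta> \<le> l (P a) - l (N a)"
        using d[OF sub(1), of a] d[OF sub(2), of a] fPN[of a] by (simp add: abs_le_iff)
    qed
    ultimately show ?thesis by simp
  qed
  then have "tightly_linear {1..20} 3 f"
    unfolding tightly_linear_def using lin by (meson not_le)
  then show ?thesis using wm by (intro exI[of _ f]) (auto simp: f_def)
qed

subsection \<open>The weak Kalton constant\<close>

definition Kalton_bound :: "real \<Rightarrow> bool" where
  "Kalton_bound K \<longleftrightarrow> (\<forall>(n::nat) \<epsilon> f. \<epsilon> \<ge> 0 \<longrightarrow> weakly_modular {1..n} \<epsilon> f \<longrightarrow> delta_linear {1..n} (K * \<epsilon>) f)"

lemma Kalton_bound_19: "Kalton_bound 19"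
  by (simp add: Kalton_bound_def weakly_modular_delta_linear)

lemma Kalton_bound_ge: "Kalton_bound K \<Longrightarrow> 3 / 2 \<le> K"
proof -
  assume K: "Kalton_bound K"
  obtain f where "weakly_modular {1..20::nat} 2 f" "tightly_linear {1..20::nat} 3 f"
    using ex_tightly_linear by blast
  then have "delta_linear {1..20} (K * 2) f" "\<And>\<Delta>. \<Delta> < 3 \<Longrightarrow> \<not> delta_linear {1..20} \<Delta> f"
    using K by (auto simp: Kalton_bound_def tightly_linear_def)
  then have "\<not> K * 2 < 3" by blast
  then show ?thesis by simp
qed

text \<open>The set of admissible constants is closed because \<open>delta_linear\<close> is closed in \<open>\<Delta>\<close>.\<close>
lemma Kalton_bound_weak_Kalton_constant: "Kalton_bound weak_Kalton_constant"
  and weak_Kalton_constant_le: "Kalton_bound K \<Longrightarrow> weak_Kalton_constant \<le> K"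
proof -
  define K0 where "K0 = Inf {K. Kalton_bound K}"
  have ne: "{K. Kalton_bound K} \<noteq> {}" using Kalton_bound_19 by blast
  have bdd: "bdd_below {K. Kalton_bound K}" using Kalton_bound_ge by (intro bdd_belowI[of _ "3 / 2"]) auto
  have lower: "K0 \<le> K" if "Kalton_bound K" for K
    unfolding K0_def using that bdd by (intro cInf_lower) auto
  have "Kalton_bound K0"
    unfolding Kalton_bound_def
  proof (intro allI impI)
    fix n :: nat and \<epsilon> :: real and f
    assume \<epsilon>: "\<epsilon> \<ge> 0" and wm: "weakly_modular {1..n} \<epsilon> f"
    show "delta_linear {1..n} (K0 * \<epsilon>) f"
    proof (rule delta_linear_closed)
      fix \<Delta> assume \<Delta>: "\<Delta> > K0 * \<epsilon>"
      show "delta_linear {1..n} \<Delta> f"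
      proof (cases "\<epsilon> = 0")
        case True
        \<comment> \<open>Division by \<open>\<epsilon>\<close> is impossible here, but the constant
          19 already gives distance \<open>19 * 0 = 0\<close>.\<close>
        then have "delta_linear {1..n} 0 f" using weakly_modular_delta_linear[OF _ wm] by simp
        then show ?thesis using \<Delta> True by (auto intro: delta_linear_mono)
      next
        case False
        then have "K0 < \<Delta> / \<epsilon>" using \<epsilon> \<Delta> by (simp add: pos_less_divide_eq)
        then obtain K where K: "Kalton_bound K" "K < \<Delta> / \<epsilon>"
          using cInf_lessD[OF ne] unfolding K0_def by blast
        then have "delta_linear {1..n} (K * \<epsilon>) f" using \<epsilon> wm by (simp add: Kalton_bound_def)
        moreover have "K * \<epsilon> \<le> \<Delta>" using K(2) \<epsilon> False by (simp add: pos_less_divide_eq)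
        ultimately show ?thesis by (rule delta_linear_mono)
      qed
    qed simp
  qed
  then have "weak_Kalton_constant = K0"
    unfolding weak_Kalton_constant_def Kalton_bound_def[symmetric]
    using lower by (intro Least_equality)
  then show "Kalton_bound weak_Kalton_constant" "Kalton_bound K \<Longrightarrow> weak_Kalton_constant \<le> K"
    using \<open>Kalton_bound K0\<close> lower by auto
qed

theorem theorem3:
  "(\<exists>K::real. K < 24 \<and>
      (\<forall>(n::nat) \<epsilon> f. n \<ge> 2 \<longrightarrow> \<epsilon> \<ge> 0 \<longrightarrow> weakly_modular {1..n} \<epsilon> f \<longrightarrow>
         delta_linear {1..n} (K * \<epsilon>) f)) \<and>
   weak_Kalton_constant < 24 \<and>
   (\<exists>(U::nat set) f. finite U \<and> card U = 20 \<and> (\<forall>S. S \<subseteq> U \<longrightarrow> f S \<in> \<int>) \<and>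
      weakly_modular U 2 f \<and> tightly_linear U 3 f) \<and>
   weak_Kalton_constant \<ge> 3 / 2"
proof (intro conjI)
  show "\<exists>K::real. K < 24 \<and>
      (\<forall>(n::nat) \<epsilon> f. n \<ge> 2 \<longrightarrow> \<epsilon> \<ge> 0 \<longrightarrow> weakly_modular {1..n} \<epsilon> f \<longrightarrow>
         delta_linear {1..n} (K * \<epsilon>) f)"
    using Kalton_bound_19 by (intro exI[of _ 19]) (simp add: Kalton_bound_def)
  show "weak_Kalton_constant < 24"
    using weak_Kalton_constant_le[OF Kalton_bound_19] by simp
  show "\<exists>(U::nat set) f. finite U \<and> card U = 20 \<and> (\<forall>S. S \<subseteq> U \<longrightarrow> f S \<in> \<int>) \<and>
      weakly_modular U 2 f \<and> tightly_linear U 3 f"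
    using ex_tightly_linear by (intro exI[of _ "{1..20}"]) simp
  show "weak_Kalton_constant \<ge> 3 / 2"
    using Kalton_bound_ge[OF Kalton_bound_weak_Kalton_constant] .
qed

end
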